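(* The following identity holds (as formal power series in $q$, and hence also as an identity of analytic functions for $|q|<1$): $$1+ \sum_{\substack{n,j,r\ge 0\\ (n,j,r)\neq(0,0,0)}} \frac{q^{3n^2+\frac92 r^2+3j^2+6nj+6nr+6rj-\frac52 r-j}\,(q^3;q^3)_{2j+r-1}\,(1+q^{2r+2j})\,(1-q^{6r+6j})}{(q^3;q^3)_n\,(q^3;q^3)_r\,(q^3;q^3)_j\,(-1;q^3)_{j+1}\,(q^3;q^3)_{n+2r+2j}} = \frac{1}{(q^2,q^3,q^9,q^{10};q^{12})_\infty},$$ where in the terms with $r=j=0$ the product $(q^3;q^3)_{2j+r-1}(1-q^{6r+6j})$ is interpreted as $1$ (so that the term with $r=j=0$ and $n\ge1$ equals $q^{3n^2}/\big((q^3;q^3)_n\big)^2$).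
   Context: Notation: $(A;q)_0=1$, $(A;q)_n=(1-A)(1-Aq)\cdots(1-Aq^{n-1})$ for $n\ge 1$, $(A;q)_\infty=\prod_{i=0}^\infty(1-Aq^i)$, and $(A_1,\dots,A_r;q)_s=(A_1;q)_s\cdots(A_r;q)_s$. *)

theory Defs
  imports "HOL-Analysis.Analysis" "HOL-Computational_Algebra.Formal_Power_Series"
begin

text \<open>
  All definitions are polymorphic, so that they apply to a formal variable (\<open>fps_X\<close>, with
  the X-adic topology on formal power series) and to a complex number alike.
\<close>

definition qpoch :: "'a::comm_ring_1 \<Rightarrow> 'a \<Rightarrow> nat \<Rightarrow> 'a" where
  "qpoch A q n = (\<Prod>i<n. 1 - A * q ^ i)"

definition qpoch_inf :: "'a::{t2_space, comm_ring_1} \<Rightarrow> 'a \<Rightarrow> 'a" where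
  "qpoch_inf A q = (\<Prod>i. 1 - A * q ^ i)"

definition qpoch_inf_list :: "'a::{t2_space, comm_ring_1} list \<Rightarrow> 'a \<Rightarrow> 'a" where
  "qpoch_inf_list As q = (\<Prod>A\<leftarrow>As. qpoch_inf A q)"

text \<open>
  The exponent is a natural number: \<open>9 * r\<^sup>2 - 5 * r\<close> is even and neither subtraction truncates
  (see \<open>real_triple_exponent\<close>).
\<close>

definition triple_exponent :: "nat \<Rightarrow> nat \<Rightarrow> nat \<Rightarrow> nat" where
  "triple_exponent n j r =
     3 * n ^ 2 + (9 * r ^ 2 - 5 * r) div 2 + (3 * j ^ 2 - j) + 6 * n * j + 6 * n * r + 6 * r * j"

lemma real_triple_exponent:
  "real (triple_exponent n j r) =
     3 * real n ^ 2 + 9 / 2 * real r ^ 2 + 3 * real j ^ 2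
       + 6 * real n * real j + 6 * real n * real r + 6 * real r * real j
       - 5 / 2 * real r - real j"
proof -
  have r: "5 * r \<le> 9 * r ^ 2"
    by (cases r) (auto simp: power2_eq_square)
  have j: "j \<le> 3 * j ^ 2"
    by (cases j) (auto simp: power2_eq_square)
  have "even (9 * r ^ 2 - 5 * r)"
    using r by (cases "even r") auto
  hence "real ((9 * r ^ 2 - 5 * r) div 2) = (9 * real r ^ 2 - 5 * real r) / 2"
    using r by (simp add: real_of_nat_div of_nat_diff)
  thus ?thesis
    using j by (simp add: triple_exponent_def of_nat_diff field_simps)
qed

text \<open>
  For \<open>r = j = 0\<close> the factor \<open>(q\<^sup>3; q\<^sup>3)\<close> would carry the index \<open>-1\<close>; its product with the
  vanishing \<open>1 - q ^ (6 * r + 6 * j)\<close> is then read as \<open>1\<close>.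
\<close>

definition triple_term :: "'a::idom_divide \<Rightarrow> nat \<Rightarrow> nat \<Rightarrow> nat \<Rightarrow> 'a" where
  "triple_term q n j r =
     (q ^ triple_exponent n j r
        * (if r = 0 \<and> j = 0 then 1
           else qpoch (q ^ 3) (q ^ 3) (2 * j + r - 1) * (1 - q ^ (6 * r + 6 * j)))
        * (1 + q ^ (2 * r + 2 * j)))
     div (qpoch (q ^ 3) (q ^ 3) n * qpoch (q ^ 3) (q ^ 3) r * qpoch (q ^ 3) (q ^ 3) j
        * qpoch (- 1) (q ^ 3) (j + 1) * qpoch (q ^ 3) (q ^ 3) (n + 2 * r + 2 * j))"

end

theory Submission
  imports Defs "HOL-Complex_Analysis.Cauchy_Integral_Formula"
begin

text \<open>
  Put \<open>p = q\<^sup>3\<close>, write \<open>(A)\<^sub>k\<close> for \<open>(A; p)\<^sub>k\<close>, and collect the terms with \<open>j + r = m\<close>. The exponent of \<open>q\<close>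
  equals \<open>3 (n\<^sup>2 + 2 m n) + (3 m\<^sup>2 - m) + 3 (r choose 2)\<close>, so the summand is a product of
  \<open>p ^ (n\<^sup>2 + 2 m n) / ((p)\<^sub>n (p)\<^sub>n\<^sub>+\<^sub>2\<^sub>m)\<close>, of the theta term \<open>q ^ (3 m\<^sup>2 - m) (1 + q ^ (2 m))\<close>, and of a
  factor that depends on \<open>m\<close> and \<open>j\<close> only (\<open>triple_term_eq\<close>). Now

  \<^item> the sum over \<open>n\<close> is \<open>1 / (p)\<^sub>\<infinity>\<close> whatever \<open>m\<close> is, by the Durfee rectangle identity
    (\<open>finite_durfee\<close>);
  \<^item> the sum over \<open>j\<close> is 1, by a q-Chu-Vandermonde sum (\<open>sum_inner_term\<close>);
  \<^item> the remaining sum over \<open>m\<close> is the theta series \<open>\<Sum>k\<in>\<int>. q ^ (3 k\<^sup>2 + k)\<close>, which Jacobi's triple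
    product turns into \<open>(q\<^sup>6; q\<^sup>6)\<^sub>\<infinity> (- q\<^sup>2; q\<^sup>6)\<^sub>\<infinity> (- q\<^sup>4; q\<^sup>6)\<^sub>\<infinity>\<close> (\<open>finite_jacobi_triple_product\<close>).

  Dividing this product by \<open>(q\<^sup>3; q\<^sup>3)\<^sub>\<infinity>\<close> leaves the right-hand side of the theorem. All three
  summations are special cases of one polynomial identity, \<open>q_chu_vandermonde\<close>, which has a short
  induction proof.

  The summations are applied in truncated form, where they are identities between finite sums
  (\<open>finite_triple_sum\<close>, \<open>finite_theta_product\<close>), and limits are taken only at the end, by Tannery's
  theorem (\<open>tannery\<close>). All that this requires of the topology is a complete submultiplicative norm
  for which \<open>q\<close> has norm less than 1. Therefore the proof is carried out in a type class that contains both formal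
  power series and complex numbers, and both versions of the identity are instances of
  \<open>triple_sum_eq\<close>. For complex \<open>q\<close> there remain the point \<open>q = 0\<close>, where powers of \<open>q\<close> cannot be
  cancelled, and analyticity, which is inherited from the product.
\<close>

section \<open>Complete normed domains\<close>

text \<open>
  Formal power series with the X-adic metric and complex numbers with the usual one have in common
  everything that the limit arguments use: the distance to 0 is a submultiplicative norm, the
  metric is complete, and division is exact by units. The last two axioms make the denominators
  units: \<open>1 - q ^ k\<close> for small \<open>q\<close>, and the factor 2 with which \<open>(- 1; q)\<close> begins. A
  power series over a field is invertible when its constant term is nonzero, so for the factor 2
  the characteristic matters.
\<close>
class complete_normed_domain = idom_divide + complete_space +
  assumes dist_eq_dist_diff_0: "dist x y = dist (x - y) 0"
    and dist_mult_0_le: "dist (x * y) 0 \<le> dist x 0 * dist y 0"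
    and dist_1_0: "dist 1 0 = 1"
    and one_minus_dvd_1: "dist x 0 < 1 \<Longrightarrow> (1 - x) dvd 1"
    and two_dvd_1: "(1 + 1) dvd 1"

instance complex :: complete_normed_domain
proof
  fix x y :: complex
  show "dist x y = dist (x - y) 0"
    by (simp add: dist_norm)
  show "dist (x * y) 0 \<le> dist x 0 * dist y 0"
    by (simp add: norm_mult)
  show "dist (1 :: complex) 0 = 1"
    by simp
  show "(1 - x) dvd 1" if "dist x 0 < 1"
    using that by (cases "x = 1") (auto simp: dvd_field_iff)
  show "(1 + 1 :: complex) dvd 1"
    by (simp add: dvd_field_iff)
qed

instance fps :: (field_char_0) complete_normed_domain
proof
  fix x y :: "'a fps"
  show "dist x y = dist (x - y) 0"
    by (simp add: dist_fps_def)
  show "dist (x * y) 0 \<le> dist x 0 * dist y 0"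
    by (simp add: dist_fps_def power_add)
  show "dist (1 :: 'a fps) 0 = 1"
    by (simp add: dist_fps_def)
  show "(1 - x) dvd 1" if "dist x 0 < 1"
    using dist_less_imp_nth_equal[of x 0 0] that by simp
  show "(1 + 1 :: 'a fps) dvd 1"
    by simp
qed

text \<open>
  This is the norm for complex numbers, and 2 to the power of minus the order for formal power series.
\<close>
definition mag :: "'a::complete_normed_domain \<Rightarrow> real" where
  "mag x = dist x 0"

lemma mag_0 [simp]: "mag 0 = 0"
  and mag_1 [simp]: "mag 1 = 1"
  and mag_nonneg [simp]: "mag x \<ge> 0"
  and mag_mult_le: "mag (x * y) \<le> mag x * mag y"
  and dist_eq_mag: "dist x y = mag (x - y)"
  by (simp_all add: mag_def dist_1_0 dist_mult_0_le flip: dist_eq_dist_diff_0)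

lemma mag_minus [simp]: "mag (- x) = mag x"
  using dist_eq_dist_diff_0[of 0 x] by (simp add: mag_def dist_commute)

lemma mag_add_le: "mag (x + y) \<le> mag x + mag y"
  using dist_triangle[of x "- y" 0] mag_minus[of y]
  by (simp add: mag_def dist_commute dist_eq_dist_diff_0[of x "- y"])

lemma mag_diff_le: "mag (x - y) \<le> mag x + mag y"
  using mag_add_le[of x "- y"] by simp

lemma mag_power_le: "mag (x ^ n) \<le> mag x ^ n"
proof (induction n)
  case (Suc n)
  have "mag (x ^ Suc n) \<le> mag x * mag (x ^ n)"
    using mag_mult_le[of x "x ^ n"] by simp
  also have "\<dots> \<le> mag x * mag x ^ n"
    by (intro mult_left_mono Suc) auto
  finally show ?case by simp
qed auto

lemma mag_sum_le: "mag (\<Sum>x\<in>A. f x) \<le> (\<Sum>x\<in>A. mag (f x))"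
proof (induction A rule: infinite_finite_induct)
  case (insert x A)
  then show ?case
    using mag_add_le[of "f x" "sum f A"] by auto
qed auto

lemma mag_mult_le_mono: "mag x \<le> a \<Longrightarrow> mag y \<le> b \<Longrightarrow> mag (x * y) \<le> a * b"
  using mag_mult_le[of x y] mult_mono[of "mag x" a "mag y" b] mag_nonneg[of x] mag_nonneg[of y]
  by linarith

lemma tendsto_mag_iff: "(f \<longlongrightarrow> l) F \<longleftrightarrow> ((\<lambda>x. mag (f x - l)) \<longlongrightarrow> 0) F"
  by (subst tendsto_dist_iff) (simp add: dist_eq_mag)

instance complete_normed_domain \<subseteq> topological_semigroup_mult
proof
  fix a b :: 'a
  have "((\<lambda>x. mag (fst x * snd x - a * b)) \<longlongrightarrow> 0) (nhds a \<times>\<^sub>F nhds b)"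
  proof (rule tendsto_sandwich[OF _ _ tendsto_const])
    let ?B = "\<lambda>x. mag (fst x - a) * mag (snd x - b) + mag (fst x - a) * mag b
                + mag a * mag (snd x - b)"
    have "mag (fst x * snd x - a * b) \<le> ?B x" for x
    proof -
      have "fst x * snd x - a * b = (fst x - a) * (snd x - b) + (fst x - a) * b + a * (snd x - b)"
        by (simp add: algebra_simps)
      then show ?thesis
        using mag_add_le[of "(fst x - a) * (snd x - b) + (fst x - a) * b" "a * (snd x - b)"]
          mag_add_le[of "(fst x - a) * (snd x - b)" "(fst x - a) * b"]
          mag_mult_le[of "fst x - a" "snd x - b"] mag_mult_le[of "fst x - a" b]
          mag_mult_le[of a "snd x - b"] by (simp only:)
    qed
    then show "\<forall>\<^sub>F x in nhds a \<times>\<^sub>F nhds b. mag (fst x * snd x - a * b) \<le> ?B x"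
      by simp
    have "((\<lambda>x. mag (fst x - a)) \<longlongrightarrow> 0) (nhds a \<times>\<^sub>F nhds b)"
         "((\<lambda>x. mag (snd x - b)) \<longlongrightarrow> 0) (nhds a \<times>\<^sub>F nhds b)"
      unfolding tendsto_mag_iff[symmetric] by (auto intro: filterlim_fst filterlim_snd)
    from tendsto_add[OF tendsto_add[OF tendsto_mult[OF this] tendsto_mult_right[OF this(1)]]
         tendsto_mult_left[OF this(2)], of "mag b" "mag a"]
    show "(?B \<longlongrightarrow> 0) (nhds a \<times>\<^sub>F nhds b)"
      by simp
  qed auto
  then show "LIM x nhds a \<times>\<^sub>F nhds b. fst x * snd x :> nhds (a * b)"
    by (simp add: tendsto_mag_iff)
qed

instance complete_normed_domain \<subseteq> topological_monoid_add
proof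
  fix a b :: 'a
  have "((\<lambda>x. mag (fst x + snd x - (a + b))) \<longlongrightarrow> 0) (nhds a \<times>\<^sub>F nhds b)"
  proof (rule tendsto_sandwich[OF _ _ tendsto_const])
    have "mag (fst x + snd x - (a + b)) \<le> mag (fst x - a) + mag (snd x - b)" for x
      using mag_add_le[of "fst x - a" "snd x - b"] by (simp add: algebra_simps)
    then show "\<forall>\<^sub>F x in nhds a \<times>\<^sub>F nhds b.
        mag (fst x + snd x - (a + b)) \<le> mag (fst x - a) + mag (snd x - b)"
      by simp
    have "((\<lambda>x. mag (fst x - a)) \<longlongrightarrow> 0) (nhds a \<times>\<^sub>F nhds b)"
         "((\<lambda>x. mag (snd x - b)) \<longlongrightarrow> 0) (nhds a \<times>\<^sub>F nhds b)"
      unfolding tendsto_mag_iff[symmetric] by (auto intro: filterlim_fst filterlim_snd)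
    from tendsto_add[OF this]
    show "((\<lambda>x. mag (fst x - a) + mag (snd x - b)) \<longlongrightarrow> 0) (nhds a \<times>\<^sub>F nhds b)"
      by simp
  qed auto
  then show "LIM x nhds a \<times>\<^sub>F nhds b. fst x + snd x :> nhds (a + b)"
    by (simp add: tendsto_mag_iff)
qed

text \<open>
  The tails of the series of norms control the distance of any two large partial sums, so the net
  of partial sums is Cauchy, as in a Banach space.
\<close>
lemma mag_summable_imp_summable_on:
  fixes w :: "'b \<Rightarrow> 'a::complete_normed_domain"
  assumes "(\<lambda>x. mag (w x)) summable_on A"
  shows "w summable_on A"
proof -
  have "\<exists>P. eventually P (finite_subsets_at_top A) \<and>
          (\<forall>F F'. P F \<and> P F' \<longrightarrow> dist (sum w F) (sum w F') < e)" if "e > 0" for e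
  proof -
    obtain F0 where F0: "finite F0" "F0 \<subseteq> A"
        "dist (sum (\<lambda>x. mag (w x)) F0) (infsum (\<lambda>x. mag (w x)) A) \<le> e / 3"
      using infsum_finite_approximation[OF assms, of "e / 3"] \<open>e > 0\<close> by auto
    have tail: "mag (sum w F - sum w F0) \<le> e / 3" if F: "finite F" "F0 \<subseteq> F" "F \<subseteq> A" for F
    proof -
      have "mag (sum w F - sum w F0) = mag (sum w (F - F0))"
        using F F0 by (simp add: sum_diff)
      also have "\<dots> \<le> (\<Sum>x\<in>F - F0. mag (w x))"
        by (rule mag_sum_le)
      also have "\<dots> = (\<Sum>x\<in>F. mag (w x)) - (\<Sum>x\<in>F0. mag (w x))"
        using F F0 by (simp add: sum_diff)
      also have "(\<Sum>x\<in>F. mag (w x)) \<le> infsum (\<lambda>x. mag (w x)) A"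
        using F assms by (intro finite_sum_le_infsum) auto
      finally show ?thesis
        using F0(3) unfolding dist_real_def by linarith
    qed
    let ?P = "\<lambda>F. finite F \<and> F0 \<subseteq> F \<and> F \<subseteq> A"
    have "dist (sum w F) (sum w F') < e" if "?P F" "?P F'" for F F'
      using dist_triangle2[of "sum w F" "sum w F'" "sum w F0"] tail[of F] tail[of F'] that \<open>e > 0\<close>
      by (simp add: dist_eq_mag)
    moreover have "eventually ?P (finite_subsets_at_top A)"
      using F0 by (auto simp: eventually_finite_subsets_at_top)
    ultimately show ?thesis
      by (intro exI[of _ ?P] conjI allI impI) auto
  qed
  then have "cauchy_filter (filtermap (sum w) (finite_subsets_at_top A))"
    by (simp add: cauchy_filter_metric_filtermap)
  moreover have "complete (UNIV :: 'a set)"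
    by (meson Cauchy_convergent UNIV_I complete_def convergent_def)
  ultimately obtain L where "(sum w \<longlongrightarrow> L) (finite_subsets_at_top A)"
    using complete_uniform[where S = UNIV] by (force simp add: filterlim_def)
  then show ?thesis
    using summable_on_def has_sum_def by blast
qed

text \<open>
  Tannery's theorem, i.e. dominated convergence for sums. Every passage from a truncated identity
  to an infinite one has this shape: the summand acquires a factor that is 0 outside a finite set
  \<open>F N\<close>, stays bounded and tends to 1.
\<close>
lemma tannery:
  fixes w :: "'b \<Rightarrow> 'a::complete_normed_domain" and c :: "nat \<Rightarrow> 'b \<Rightarrow> 'a"
  assumes w: "(\<lambda>x. mag (w x)) summable_on A"
    and F: "\<And>N. finite (F N)" "\<And>N. F N \<subseteq> A" "\<And>x. x \<in> A \<Longrightarrow> \<forall>\<^sub>F N in sequentially. x \<in> F N"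
    and c: "\<And>N x. x \<in> F N \<Longrightarrow> mag (c N x) \<le> C" "\<And>x. x \<in> A \<Longrightarrow> (\<lambda>N. c N x) \<longlonglongrightarrow> 1"
  shows "(\<lambda>N. \<Sum>x\<in>F N. w x * c N x) \<longlonglongrightarrow> infsum w A"
proof -
  define C' where "C' = max C 1"
  have C': "C' \<ge> 1" "\<And>N x. x \<in> F N \<Longrightarrow> mag (c N x) \<le> C'"
    using c(1) by (auto simp: C'_def intro: max.coboundedI1)
  let ?I = "infsum (\<lambda>x. mag (w x)) A"
  have "(\<lambda>N. mag ((\<Sum>x\<in>F N. w x * c N x) - infsum w A)) \<longlonglongrightarrow> 0"
  proof (rule LIMSEQ_I)
    fix e :: real assume "e > 0"
    \<comment> \<open>the error has three parts: a tail, a finite sum with factors near 1, and a partial sum near its limit; \<open>F1\<close> makes the tail small and \<open>F2\<close> the last part\<close>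
    define d where "d = e / (4 * C')"
    have d: "d > 0" "C' * d = e / 4" "d \<le> e / 4"
      using \<open>e > 0\<close> C'(1) by (auto simp: d_def field_simps)
    obtain F1 where F1: "finite F1" "F1 \<subseteq> A"
        "dist (sum (\<lambda>x. mag (w x)) F1) ?I \<le> d"
      using infsum_finite_approximation[OF w d(1)] by auto
    have "\<forall>\<^sub>F G in finite_subsets_at_top A. dist (sum w G) (infsum w A) < d"
      using tendstoD[OF _ d(1)] has_sum_infsum[OF mag_summable_imp_summable_on[OF w]]
      by (simp add: has_sum_def)
    then obtain F2 where F2: "finite F2" "F2 \<subseteq> A"
        "\<And>G. finite G \<Longrightarrow> F2 \<subseteq> G \<Longrightarrow> G \<subseteq> A \<Longrightarrow> dist (sum w G) (infsum w A) < d"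
      unfolding eventually_finite_subsets_at_top by auto
    define F0 where "F0 = F1 \<union> F2"
    have F0: "finite F0" "F0 \<subseteq> A"
      using F1 F2 by (auto simp: F0_def)
    have close: "mag (sum w F0 - infsum w A) < e / 4"
      using F2(3)[of F0] F0 d by (auto simp: F0_def dist_eq_mag)
    have tail: "(\<Sum>x\<in>G. mag (w x)) \<le> d" if G: "finite G" "G \<subseteq> A - F0" for G
    proof -
      have "(\<Sum>x\<in>G. mag (w x)) + (\<Sum>x\<in>F1. mag (w x)) = (\<Sum>x\<in>G \<union> F1. mag (w x))"
        using G F1 by (subst sum.union_disjoint) (auto simp: F0_def)
      also have "\<dots> \<le> ?I"
        using G F1 w by (intro finite_sum_le_infsum) auto
      finally show ?thesis
        using F1(3) by (simp add: dist_real_def)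
    qed
    have "(\<lambda>N. \<Sum>x\<in>F0. mag (w x) * mag (c N x - 1)) \<longlonglongrightarrow> (\<Sum>x\<in>F0. mag (w x) * 0)"
      using F0 c(2) by (intro tendsto_intros) (auto simp flip: tendsto_mag_iff)
    then have "\<forall>\<^sub>F N in sequentially. (\<Sum>x\<in>F0. mag (w x) * mag (c N x - 1)) < e / 4"
      using \<open>e > 0\<close> by (intro order_tendstoD(2)[of _ 0]) auto
    moreover have "\<forall>\<^sub>F N in sequentially. F0 \<subseteq> F N"
      using F0 F(3) unfolding subset_eq by (intro eventually_ball_finite) auto
    ultimately have "\<forall>\<^sub>F N in sequentially. mag ((\<Sum>x\<in>F N. w x * c N x) - infsum w A) < e"
    proof eventually_elim
      case (elim N)
      have "(\<Sum>x\<in>F N. w x * c N x) = (\<Sum>x\<in>F N - F0. w x * c N x) + (\<Sum>x\<in>F0. w x * c N x)"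
        using elim(2) F(1) by (rule sum.subset_diff)
      also have "(\<Sum>x\<in>F0. w x * c N x) = (\<Sum>x\<in>F0. w x * (c N x - 1)) + sum w F0"
        by (simp add: algebra_simps sum_subtractf)
      finally have split: "(\<Sum>x\<in>F N. w x * c N x) - infsum w A =
          (\<Sum>x\<in>F N - F0. w x * c N x) + (\<Sum>x\<in>F0. w x * (c N x - 1)) + (sum w F0 - infsum w A)"
        by simp
      have "mag (\<Sum>x\<in>F N - F0. w x * c N x) \<le> (\<Sum>x\<in>F N - F0. mag (w x) * C')"
        by (rule order_trans[OF mag_sum_le]) (auto intro!: sum_mono mag_mult_le_mono C')
      also have "\<dots> = C' * (\<Sum>x\<in>F N - F0. mag (w x))"
        by (simp add: sum_distrib_left mult.commute)
      also have "\<dots> \<le> C' * d"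
        using tail[of "F N - F0"] F C' by (intro mult_left_mono) auto
      finally have 1: "mag (\<Sum>x\<in>F N - F0. w x * c N x) \<le> e / 4"
        using d by simp
      have 2: "mag (\<Sum>x\<in>F0. w x * (c N x - 1)) < e / 4"
        by (rule order.strict_trans1[OF order_trans[OF mag_sum_le] elim(1)])
          (auto intro!: sum_mono mag_mult_le)
      show ?case
        unfolding split
        using mag_add_le[of "(\<Sum>x\<in>F N - F0. w x * c N x) + (\<Sum>x\<in>F0. w x * (c N x - 1))"
            "sum w F0 - infsum w A"]
          mag_add_le[of "\<Sum>x\<in>F N - F0. w x * c N x" "\<Sum>x\<in>F0. w x * (c N x - 1)"]
          1 2 close \<open>e > 0\<close> by linarith
    qed
    then show "\<exists>N0. \<forall>N\<ge>N0. norm (mag ((\<Sum>x\<in>F N. w x * c N x) - infsum w A) - 0) < e"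
      by (simp add: eventually_sequentially)
  qed
  then show ?thesis
    by (simp add: tendsto_mag_iff)
qed

section \<open>Finite q-series identities\<close>

lemma qpoch_0 [simp]: "qpoch A q 0 = 1"
  and qpoch_Suc: "qpoch A q (Suc n) = qpoch A q n * (1 - A * q ^ n)"
  by (simp_all add: qpoch_def)

lemma qpoch_add: "qpoch A q (m + n) = qpoch A q m * qpoch (A * q ^ m) q n"
  by (induction n) (simp_all add: qpoch_Suc power_add mult.assoc)

lemma qpoch_mult_interval:
  "m \<le> n \<Longrightarrow> qpoch A q m * (\<Prod>i\<in>{m..<n}. 1 - A * q ^ i) = qpoch A q n"
  unfolding qpoch_def lessThan_atLeast0 by (rule prod.atLeastLessThan_concat) auto

text \<open>
  Gaussian binomial coefficients. The recursion needs no division, so the identities below hold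
  in every commutative ring; the usual quotient formula is \<open>qbinom_mult_qpoch\<close>.
\<close>
fun qbinom :: "'a::comm_ring_1 \<Rightarrow> nat \<Rightarrow> nat \<Rightarrow> 'a" where
  "qbinom p n 0 = 1"
| "qbinom p 0 (Suc k) = 0"
| "qbinom p (Suc n) (Suc k) = qbinom p n k + p ^ Suc k * qbinom p n (Suc k)"

lemma qbinom_eq_0: "n < k \<Longrightarrow> qbinom p n k = 0"
  by (induction p n k rule: qbinom.induct) auto

lemma qbinom_mult_qpoch:
  "k \<le> n \<Longrightarrow> qbinom p n k * (qpoch p p k * qpoch p p (n - k)) = qpoch p p n"
proof (induction p n k rule: qbinom.induct)
  case (3 p n k)
  have "k \<le> n"
    using 3 by simp
  have 1: "qbinom p n k * (qpoch p p (Suc k) * qpoch p p (n - k)) = qpoch p p n * (1 - p ^ Suc k)"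
    unfolding 3(1)[OF \<open>k \<le> n\<close>, symmetric] by (simp add: qpoch_Suc mult_ac)
  have 2: "qbinom p n (Suc k) * (qpoch p p (Suc k) * qpoch p p (n - k)) = qpoch p p n * (1 - p ^ (n - k))"
  proof (cases "k = n")
    case True
    then show ?thesis by (simp add: qbinom_eq_0)
  next
    case False
    then have "Suc k \<le> n" and "n - k = Suc (n - Suc k)"
      using \<open>k \<le> n\<close> by auto
    then show ?thesis
      unfolding 3(2)[OF \<open>Suc k \<le> n\<close>, symmetric] \<open>n - k = _\<close>
      by (simp add: qpoch_Suc[of p p "n - Suc k"] mult_ac)
  qed
  have "qbinom p (Suc n) (Suc k) * (qpoch p p (Suc k) * qpoch p p (n - k))
      = qpoch p p n * (1 - p ^ Suc k) + p ^ Suc k * (qpoch p p n * (1 - p ^ (n - k)))"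
    unfolding 1[symmetric] 2[symmetric] by (simp add: algebra_simps)
  also have "\<dots> = qpoch p p n * (1 - p ^ Suc k * p ^ (n - k))"
    by (simp add: algebra_simps)
  also have "p ^ Suc k * p ^ (n - k) = p ^ Suc n"
    unfolding power_add[symmetric] using \<open>k \<le> n\<close> by simp
  finally show ?case
    by (simp add: qpoch_Suc)
qed auto

lemma Suc_choose_two: "Suc n choose 2 = (n choose 2) + n"
  by (simp add: numeral_2_eq_2)

lemma zero_choose_two [simp]: "0 choose 2 = 0"
  by (simp add: numeral_2_eq_2)

lemma add_choose_two: "m + n choose 2 = (m choose 2) + (n choose 2) + m * n"
  by (induction n) (simp_all add: Suc_choose_two)

lemma square_eq_choose_two: "n * n = 2 * (n choose 2) + n"
  by (induction n) (simp_all add: Suc_choose_two)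

text \<open>
  A homogeneous form of the q-Chu-Vandermonde sum. The parameters \<open>s\<close> and \<open>t\<close> may vanish, and so
  this contains three classical identities: \<open>t = 0\<close> is the q-binomial theorem, \<open>s = 0\<close> is the
  Durfee rectangle identity, and \<open>s = t\<close> is the q-Chu-Vandermonde sum itself. By the q-Pascal rule
  the sums \<open>G m s t\<close> satisfy \<open>G (m + 1) s t = (a - s) * G m (s * p) (t * p)\<close>, which is also the
  recurrence of the product on the right.
\<close>
lemma q_chu_vandermonde:
  fixes a p s t :: "'a::comm_ring_1"
  shows "(\<Sum>j\<le>m. qbinom p m j * ((-1) ^ j * p ^ (j choose 2) * a ^ (m - j)
            * (\<Prod>i<j. s - a * t * p ^ i) * (\<Prod>i\<in>{j..<m}. 1 - t * p ^ i)))
          = (\<Prod>i<m. a - s * p ^ i)"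
proof (induction m arbitrary: s t)
  case (Suc m)
  define U where "U j = (-1) ^ j * p ^ (j choose 2) * a ^ (Suc m - j)
      * (\<Prod>i<j. s - a * t * p ^ i) * (\<Prod>i\<in>{j..<Suc m}. 1 - t * p ^ i)" for j
  define V where "V j = (-1) ^ j * p ^ (j choose 2) * a ^ (m - j)
      * (\<Prod>i<j. s * p - a * (t * p) * p ^ i) * (\<Prod>i\<in>{j..<m}. 1 - t * p * p ^ i)" for j
  \<comment> \<open>the two terms differ only in one factor, and \<open>a * (1 - t * p ^ j) - (s - a * t * p ^ j) = a - s\<close>\<close>
  have step: "U (Suc j) + p ^ j * U j = (a - s) * V j" if "j \<le> m" for j
  proof -
    have 1: "p ^ j * (\<Prod>i<j. s - a * t * p ^ i) = (\<Prod>i<j. s * p - a * (t * p) * p ^ i)"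
    proof -
      have "p ^ j * (\<Prod>i<j. s - a * t * p ^ i) = (\<Prod>i<j. p * (s - a * t * p ^ i))"
        by (simp add: prod.distrib)
      then show ?thesis
        by (simp add: algebra_simps)
    qed
    have 2: "(\<Prod>i\<in>{Suc j..<Suc m}. 1 - t * p ^ i) = (\<Prod>i\<in>{j..<m}. 1 - t * p * p ^ i)"
      by (subst prod.shift_bounds_Suc_ivl) (simp add: mult.assoc)
    have 3: "(\<Prod>i\<in>{j..<Suc m}. 1 - t * p ^ i) =
        (1 - t * p ^ j) * (\<Prod>i\<in>{Suc j..<Suc m}. 1 - t * p ^ i)"
      using that by (subst prod.atLeast_Suc_lessThan) auto
    have 4: "a ^ (Suc m - j) = a * a ^ (m - j)"
      using that by (simp add: Suc_diff_le)
    have "U (Suc j) + p ^ j * U j = (-1) ^ j * p ^ (j choose 2) * a ^ (m - j)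
        * (p ^ j * (\<Prod>i<j. s - a * t * p ^ i)) * (\<Prod>i\<in>{Suc j..<Suc m}. 1 - t * p ^ i)
        * (a * (1 - t * p ^ j) - (s - a * t * p ^ j))"
      unfolding U_def 3 4 by (simp add: Suc_choose_two power_add algebra_simps)
    also have "\<dots> = (a - s) * V j"
      unfolding 1 2 V_def by (simp add: algebra_simps)
    finally show ?thesis .
  qed
  have "(\<Sum>j\<le>Suc m. qbinom p (Suc m) j * U j)
      = (\<Sum>j\<le>m. qbinom p m j * U (Suc j)) + (U 0 + (\<Sum>j\<le>m. p ^ Suc j * qbinom p m (Suc j) * U (Suc j)))"
    by (subst sum.atMost_Suc_shift) (simp add: algebra_simps sum.distrib)
  also have "U 0 + (\<Sum>j\<le>m. p ^ Suc j * qbinom p m (Suc j) * U (Suc j))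
      = (\<Sum>j\<le>Suc m. p ^ j * qbinom p m j * U j)"
    by (rule sym, subst sum.atMost_Suc_shift) simp
  also have "\<dots> = (\<Sum>j\<le>m. p ^ j * qbinom p m j * U j)"
    by (simp add: qbinom_eq_0)
  also have "(\<Sum>j\<le>m. qbinom p m j * U (Suc j)) + \<dots> = (\<Sum>j\<le>m. qbinom p m j * (U (Suc j) + p ^ j * U j))"
    by (simp add: algebra_simps sum.distrib)
  also have "\<dots> = (a - s) * (\<Sum>j\<le>m. qbinom p m j * V j)"
    unfolding sum_distrib_left by (intro sum.cong refl) (simp add: step mult.left_commute)
  also have "(\<Sum>j\<le>m. qbinom p m j * V j) = (\<Prod>i<m. a - s * p * p ^ i)"
    unfolding V_def by (rule Suc.IH)
  also have "(a - s) * \<dots> = (\<Prod>i<Suc m. a - s * p ^ i)"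
    by (subst prod.lessThan_Suc_shift) (simp add: mult.assoc)
  finally show ?case
    unfolding U_def .
qed simp

lemma mult_rcp:
  fixes u :: "'a::idom_divide"
  assumes "u dvd 1"
  shows "u * (1 div u) = 1"
proof -
  obtain k where k: "k * u = 1"
    using assms by (metis dvdE mult.commute)
  then have "u \<noteq> 0"
    by auto
  then have "1 div u = k"
    using k nonzero_mult_div_cancel_right[of u k] by auto
  then show ?thesis
    using k by (simp add: mult.commute)
qed

lemma qbinom_eq:
  fixes p :: "'a::idom_divide"
  assumes "\<And>k. qpoch p p k dvd 1" "k \<le> n"
  shows "qbinom p n k = qpoch p p n * ((1 div qpoch p p k) * (1 div qpoch p p (n - k)))"
  unfolding qbinom_mult_qpoch[OF assms(2), of p, symmetric]
  using mult_rcp[OF assms(1)[of k]] mult_rcp[OF assms(1)[of "n - k"]] by algebra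

lemma qpoch_eq_rcp:
  fixes p :: "'a::idom_divide"
  assumes "qpoch A p m dvd 1" "m \<le> n"
  shows "(\<Prod>i\<in>{m..<n}. 1 - A * p ^ i) = qpoch A p n * (1 div qpoch A p m)"
  using mult_rcp[OF assms(1)] qpoch_mult_interval[OF assms(2), of A p] by algebra

text \<open>
  The Durfee rectangle identity, cut off at \<open>M\<close>: the case \<open>a = 1\<close>, \<open>s = 0\<close>, \<open>t = p ^ Suc e\<close> of
  \<open>q_chu_vandermonde\<close>, divided by the two q-Pochhammer symbols on the right. It removes the
  summation over \<open>n\<close> from the triple sum.
\<close>
lemma finite_durfee:
  fixes p :: "'a::idom_divide"
  assumes unit: "\<And>k. qpoch p p k dvd 1"
  shows "(\<Sum>n\<le>M. p ^ (n ^ 2 + e * n) *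
            ((1 div qpoch p p n) * (1 div qpoch p p (n + e)) * (1 div qpoch p p (M - n))))
          = (1 div qpoch p p M) * (1 div qpoch p p (M + e))"
proof -
  let ?i = "\<lambda>k. 1 div qpoch p p k"
  have summand: "p ^ (n ^ 2 + e * n) * (?i n * ?i (n + e) * ?i (M - n))
      = ?i M * ?i (M + e) * (qbinom p M n * ((-1) ^ n * p ^ (n choose 2) * 1 ^ (M - n)
          * (\<Prod>i<n. 0 - 1 * p ^ Suc e * p ^ i) * (\<Prod>i\<in>{n..<M}. 1 - p ^ Suc e * p ^ i)))"
    if "n \<le> M" for n
  proof -
    have "(-1) ^ n * (\<Prod>i<n. 0 - 1 * p ^ Suc e * p ^ i) = p ^ (Suc e * n + (n choose 2))"
    proof (induction n)
      case (Suc n)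
      have "(-1) ^ Suc n * (\<Prod>i<Suc n. 0 - 1 * p ^ Suc e * p ^ i)
          = ((-1) ^ n * (\<Prod>i<n. 0 - 1 * p ^ Suc e * p ^ i)) * (p ^ Suc e * p ^ n)"
        by (simp add: algebra_simps)
      then show ?case
        unfolding Suc by (simp add: Suc_choose_two algebra_simps flip: power_add)
    qed simp
    then have A: "(-1) ^ n * p ^ (n choose 2) * 1 ^ (M - n) * (\<Prod>i<n. 0 - 1 * p ^ Suc e * p ^ i)
        = p ^ (n ^ 2 + e * n)"
      unfolding power2_eq_square square_eq_choose_two by (simp add: algebra_simps power_add power2_eq_square mult_2)
    have "(\<Prod>i\<in>{n..<M}. 1 - p ^ Suc e * p ^ i) = (\<Prod>i\<in>{n + e..<M + e}. 1 - p * p ^ i)"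
      by (subst prod.shift_bounds_nat_ivl) (simp add: power_add mult_ac)
    also have "\<dots> = qpoch p p (M + e) * ?i (n + e)"
      using that by (intro qpoch_eq_rcp unit) simp
    finally show ?thesis
      unfolding A qbinom_eq[OF unit that]
    proof (simp only:)
      have "?i M * ?i (M + e) * (qpoch p p M * (?i n * ?i (M - n))
              * (p ^ (n\<^sup>2 + e * n) * (qpoch p p (M + e) * ?i (n + e))))
          = (qpoch p p M * ?i M) * (qpoch p p (M + e) * ?i (M + e))
              * (p ^ (n\<^sup>2 + e * n) * (?i n * ?i (n + e) * ?i (M - n)))"
        by (simp only: mult_ac)
      then show "p ^ (n\<^sup>2 + e * n) * (?i n * ?i (n + e) * ?i (M - n))
          = ?i M * ?i (M + e) * (qpoch p p M * (?i n * ?i (M - n))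
              * (p ^ (n\<^sup>2 + e * n) * (qpoch p p (M + e) * ?i (n + e))))"
        unfolding mult_rcp[OF unit] by (simp only: mult_1_left)
    qed
  qed
  have "(\<Sum>n\<le>M. p ^ (n ^ 2 + e * n) * (?i n * ?i (n + e) * ?i (M - n)))
      = ?i M * ?i (M + e) * (\<Prod>i<M. 1 - 0 * p ^ i)"
    unfolding q_chu_vandermonde[of p M 1 0 "p ^ Suc e", symmetric] sum_distrib_left
    by (intro sum.cong refl summand) simp
  then show ?thesis
    by simp
qed

lemma prod_geometric:
  fixes p z :: "'a::comm_ring_1"
  shows "(\<Prod>i<n. z * p ^ i) = z ^ n * p ^ (n choose 2)"
  by (induction n) (simp_all add: Suc_choose_two power_add mult_ac)

lemma diff_choose_two:
  assumes "j \<le> m"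
  shows "(m - j choose 2) + (Suc m choose 2) = (Suc j choose 2) + m * (m - j)"
proof -
  obtain l where "m = j + l"
    using assms by (auto simp: le_iff_add)
  then show ?thesis
    using square_eq_choose_two[of l] by (simp add: Suc_choose_two add_choose_two algebra_simps)
qed

text \<open>
  The case \<open>a = p ^ m\<close>, \<open>s = t = - p\<close> of \<open>q_chu_vandermonde\<close>. All terms and the right-hand side
  share the factor \<open>p ^ (Suc m choose 2)\<close>, which is cancelled.
\<close>
lemma qbinom_sum_eq_qpoch_minus_1:
  fixes p :: "'a::idom"
  assumes "p \<noteq> 0"
  shows "(\<Sum>j\<le>m. qbinom p m j * (p ^ (m - j choose 2) * qpoch (p ^ m) p j
            * (\<Prod>i\<in>{j..<m}. 1 + p ^ Suc i))) = qpoch (-1) p m"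
proof -
  have summand: "qbinom p m j * ((-1) ^ j * p ^ (j choose 2) * (p ^ m) ^ (m - j)
            * (\<Prod>i<j. - p - p ^ m * - p * p ^ i) * (\<Prod>i\<in>{j..<m}. 1 - - p * p ^ i))
      = p ^ (Suc m choose 2) * (qbinom p m j * (p ^ (m - j choose 2) * qpoch (p ^ m) p j
            * (\<Prod>i\<in>{j..<m}. 1 + p ^ Suc i)))" if "j \<le> m" for j
  proof -
    have "(\<Prod>i<j. - p - p ^ m * - p * p ^ i) = (\<Prod>i<j. (- p) * (1 - p ^ m * p ^ i))"
      by (simp add: algebra_simps)
    also have "\<dots> = (-1) ^ j * p ^ j * qpoch (p ^ m) p j"
      unfolding prod.distrib qpoch_def by (simp flip: power_mult_distrib)
    finally have "(-1) ^ j * p ^ (j choose 2) * (p ^ m) ^ (m - j) * (\<Prod>i<j. - p - p ^ m * - p * p ^ i)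
        = p ^ ((Suc j choose 2) + m * (m - j)) * qpoch (p ^ m) p j"
      by (simp add: Suc_choose_two power_add power_mult mult_ac flip: power_mult_distrib)
    then show ?thesis
      unfolding diff_choose_two[OF that, symmetric] by (simp add: power_add mult_ac)
  qed
  have "p ^ (Suc m choose 2) * (\<Sum>j\<le>m. qbinom p m j * (p ^ (m - j choose 2) * qpoch (p ^ m) p j
            * (\<Prod>i\<in>{j..<m}. 1 + p ^ Suc i))) = (\<Prod>i<m. p ^ m - - p * p ^ i)"
    unfolding q_chu_vandermonde[of p m "p ^ m" "- p" "- p", symmetric] sum_distrib_left
    by (intro sum.cong refl summand[symmetric]) simp
  also have "\<dots> = (\<Prod>i<m. p ^ m + p ^ Suc i)"
    by simp
  also have "\<dots> = (\<Prod>i<m. p ^ m + p ^ Suc (m - Suc i))"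
    by (subst prod.nat_diff_reindex[symmetric]) simp
  also have "\<dots> = (\<Prod>i<m. p ^ (m - i) * (1 - (-1) * p ^ i))"
    by (intro prod.cong) (auto simp: algebra_simps Suc_diff_Suc simp flip: power_add power_Suc)
  also have "\<dots> = (\<Prod>i<m. p ^ (m - i)) * qpoch (-1) p m"
    by (simp add: prod.distrib qpoch_def)
  also have "(\<Prod>i<m. p ^ (m - i)) = p ^ (Suc m choose 2)"
    by (induction m) (simp_all add: prod.lessThan_Suc_shift Suc_choose_two power_add mult_ac del: prod.lessThan_Suc)
  finally show ?thesis
    using assms by simp
qed

text \<open>
  MacMahon's finite form of Jacobi's triple product, folded at its middle index: the terms with
  index \<open>N + m\<close> and \<open>N - m\<close> of the q-binomial theorem for \<open>2 * N\<close> are combined, so that no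
  negative exponents occur. The variable \<open>w = p / z\<close> replaces the negative powers of \<open>z\<close>.
\<close>
lemma finite_jacobi_triple_product:
  fixes p z w :: "'a::idom"
  assumes zw: "z * w = p" and "p \<noteq> 0"
  shows "(\<Sum>m\<le>N. p ^ (m choose 2) * (if m = 0 then qbinom p (2 * N) N else
            z ^ m * qbinom p (2 * N) (N + m) + w ^ m * qbinom p (2 * N) (N - m)))
         = qpoch (- z) p N * qpoch (- w) p N"
proof -
  \<comment> \<open>the common factor of all terms, equal to the middle term without its binomial coefficient\<close>
  define K where "K = z ^ N * p ^ (N choose 2) * p ^ (N * N)"
  define g where "g k = qbinom p (2 * N) k * (p ^ (k choose 2) * p ^ (N * (2 * N - k)) * z ^ k)" for k
  have "z \<noteq> 0"
    using assms by auto
  have up: "g (N + m) = K * (p ^ (m choose 2) * (z ^ m * qbinom p (2 * N) (N + m)))" if "m \<le> N" for m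
  proof -
    have "(N + m choose 2) + N * (2 * N - (N + m)) = (N choose 2) + N * N + (m choose 2)"
      using that by (auto simp: le_iff_add add_choose_two algebra_simps)
    then show ?thesis
      unfolding g_def K_def power_add[symmetric]
      by (simp add: power_add mult_ac)
  qed
  have down: "g (N - m) = K * (p ^ (m choose 2) * (w ^ m * qbinom p (2 * N) (N - m)))" if "m \<le> N" for m
  proof -
    define l where "l = N - m"
    have N: "N = l + m"
      using that by (simp add: l_def)
    have "(l choose 2) + N * (2 * N - l) = (N choose 2) + N * N + (m choose 2) + m"
      unfolding N add_choose_two using square_eq_choose_two[of m] by (simp add: algebra_simps)
    then have "p ^ (l choose 2) * p ^ (N * (2 * N - l)) * z ^ l
        = p ^ (N choose 2) * p ^ (N * N) * p ^ (m choose 2) * (p ^ m * z ^ l)"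
      by (simp add: mult.assoc[symmetric] flip: power_add)
    also have "p ^ m * z ^ l = w ^ m * z ^ N"
      by (simp add: N zw[symmetric] power_mult_distrib power_add mult_ac)
    finally show ?thesis
      unfolding g_def K_def l_def[symmetric] by (simp add: mult_ac)
  qed
  have "K * (\<Sum>m\<le>N. p ^ (m choose 2) * (if m = 0 then qbinom p (2 * N) N else
            z ^ m * qbinom p (2 * N) (N + m) + w ^ m * qbinom p (2 * N) (N - m)))
      = (\<Sum>m\<le>N. if m = 0 then g N else g (N + m) + g (N - m))"
    unfolding sum_distrib_left using up[of 0] by (intro sum.cong) (auto simp: up down distrib_left)
  also have "\<dots> = g N + (\<Sum>m\<in>{1..N}. g (N + m)) + (\<Sum>m\<in>{1..N}. g (N - m))"
  proof -
    have "{..N} = insert 0 {1..N}"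
      by auto
    then show ?thesis
      by (simp add: sum.distrib)
  qed
  also have "\<dots> = (\<Sum>k\<le>2 * N. g k)"
  proof -
    have "(\<Sum>m\<in>{1..N}. g (N + m)) = (\<Sum>k\<in>{N<..2 * N}. g k)"
      by (rule sum.reindex_bij_witness[of _ "\<lambda>k. k - N" "\<lambda>m. N + m"]) auto
    moreover have "(\<Sum>m\<in>{1..N}. g (N - m)) = (\<Sum>k<N. g k)"
      by (rule sum.reindex_bij_witness[of _ "\<lambda>k. N - k" "\<lambda>m. N - m"]) auto
    moreover have "{..2 * N} = ({..<N} \<union> {N}) \<union> {N<..2 * N}"
      by auto
    ultimately show ?thesis
      by (simp only:) (subst sum.union_disjoint, auto simp: add_ac)
  qed
  also have "\<dots> = (\<Prod>i<2 * N. p ^ N - - z * p ^ i)"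
    unfolding q_chu_vandermonde[of p "2 * N" "p ^ N" "- z" 0, symmetric] g_def
    by (intro sum.cong) (simp_all add: power_mult mult_ac flip: power_mult_distrib)
  also have "\<dots> = (\<Prod>i<N. p ^ N - - z * p ^ i) * (\<Prod>i<N. p ^ N - - z * p ^ (N + i))"
    by (simp add: mult_2 prod.nat_group lessThan_atLeast0 prod.atLeastLessThan_concat[of 0 N "N + N", symmetric]
        prod.shift_bounds_nat_ivl[of _ 0 N N, simplified] add.commute)
  also have "(\<Prod>i<N. p ^ N - - z * p ^ (N + i)) = p ^ (N * N) * qpoch (- z) p N"
  proof -
    have "(\<Prod>i<N. p ^ N - - z * p ^ (N + i)) = (\<Prod>i<N. p ^ N * (1 - - z * p ^ i))"
      by (simp add: power_add algebra_simps)
    then show ?thesis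
      by (simp add: prod.distrib qpoch_def power_mult)
  qed
  also have "(\<Prod>i<N. p ^ N - - z * p ^ i) = (\<Prod>i<N. z * p ^ i * (1 - - w * p ^ (N - Suc i)))"
  proof (intro prod.cong refl)
    fix i assume "i \<in> {..<N}"
    then have "p ^ N = p ^ i * (p * p ^ (N - Suc i))"
      by (simp flip: power_add power_Suc)
    then show "p ^ N - - z * p ^ i = z * p ^ i * (1 - - w * p ^ (N - Suc i))"
      by (simp add: zw[symmetric] algebra_simps)
  qed
  also have "\<dots> = z ^ N * p ^ (N choose 2) * qpoch (- w) p N"
    by (subst prod.distrib)
      (simp only: prod_geometric prod.nat_diff_reindex[of "\<lambda>i. 1 - - w * p ^ i"] qpoch_def)
  finally show ?thesis
    using \<open>z \<noteq> 0\<close> \<open>p \<noteq> 0\<close> by (simp add: K_def mult_ac)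
qed

section \<open>Bounds and limits of q-Pochhammer symbols\<close>

lemma one_minus_unit: "mag x < 1 \<Longrightarrow> (1 - x) dvd 1"
  by (simp add: mag_def one_minus_dvd_1)

lemma mag_power_less_1: "mag q < 1 \<Longrightarrow> k > 0 \<Longrightarrow> mag (q ^ k) < 1"
  using order.strict_trans1[OF mag_power_le, of q k 1] by (simp add: power_less_one_iff)

text \<open>
  The norm analogue of \<open>\<bar>(\<Prod>i. 1 - x i) - 1\<bar> \<le> (\<Prod>i. 1 + \<bar>x i\<bar>) - 1\<close>. The bound by an exponential is
  uniform in the number of factors, which is what limits with a growing number of factors need.
\<close>
lemma mag_prod_minus_1_le:
  "finite I \<Longrightarrow> mag ((\<Prod>i\<in>I. 1 - x i) - 1) \<le> exp (\<Sum>i\<in>I. mag (x i)) - 1"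
proof (induction I rule: finite_induct)
  case (insert j I)
  define P E where "P = (\<Prod>i\<in>I. 1 - x i)" and "E = exp (\<Sum>i\<in>I. mag (x i))"
  have "E \<ge> 1"
    by (simp add: E_def sum_nonneg)
  have "(1 - x j) * P - 1 = (P - 1) * (1 - x j) - x j"
    by (simp add: algebra_simps)
  then have "mag ((1 - x j) * P - 1) \<le> mag ((P - 1) * (1 - x j)) + mag (x j)"
    using mag_diff_le by metis
  also have "mag ((P - 1) * (1 - x j)) \<le> (E - 1) * (1 + mag (x j))"
    using insert.IH mag_diff_le[of 1 "x j"] by (intro mag_mult_le_mono) (auto simp: P_def E_def)
  also have "(E - 1) * (1 + mag (x j)) + mag (x j) = E * (1 + mag (x j)) - 1"
    by (simp add: algebra_simps)
  also have "\<dots> \<le> E * exp (mag (x j)) - 1"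
    using \<open>E \<ge> 1\<close> by (intro diff_right_mono mult_left_mono exp_ge_add_one_self) auto
  finally show ?case
    using insert.hyps by (simp add: P_def E_def exp_add mult.commute)
qed auto

lemma mag_prod_le: "finite I \<Longrightarrow> mag (\<Prod>i\<in>I. 1 - x i) \<le> exp (\<Sum>i\<in>I. mag (x i))"
  using mag_prod_minus_1_le[of I x] mag_add_le[of "(\<Prod>i\<in>I. 1 - x i) - 1" 1] by simp

lemma rcp_mult:
  fixes u v :: "'a::idom_divide"
  assumes "u dvd 1" "v dvd 1"
  shows "1 div (u * v) = (1 div u) * (1 div v)"
proof -
  have "(1 div u) * (1 div v) * (u * v) = (u * (1 div u)) * (v * (1 div v))"
    by (simp only: mult_ac)
  then have eq: "(1 div u) * (1 div v) * (u * v) = 1"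
    unfolding mult_rcp[OF assms(1)] mult_rcp[OF assms(2)] by simp
  then have "u * v \<noteq> 0"
    by auto
  from nonzero_mult_div_cancel_right[OF this, of "(1 div u) * (1 div v)"] eq show ?thesis
    by simp
qed

lemma unit_mult: "u dvd 1 \<Longrightarrow> v dvd 1 \<Longrightarrow> u * v dvd (1::'a::comm_monoid_mult)"
  using mult_dvd_mono[of u 1 v 1] by simp

text \<open>
  The reciprocal satisfies \<open>u = 1 + x * u\<close>, which bounds it without expanding a geometric series.
\<close>
lemma mag_rcp_one_minus_le:
  assumes "mag x \<le> d" "d < 1"
  shows "mag (1 div (1 - x)) \<le> exp (mag x / (1 - d))"
proof -
  define u where "u = 1 div (1 - x)"
  have "(1 - x) * u = 1"
    unfolding u_def using assms by (intro mult_rcp one_minus_unit) simp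
  then have "u = 1 + x * u"
    by (simp add: algebra_simps)
  then have "mag u \<le> 1 + mag x * mag u"
    using mag_add_le[of 1 "x * u"] mag_mult_le[of x u] by simp
  then have "mag u * (1 - mag x) \<le> 1"
    by (simp add: algebra_simps)
  then have "mag u \<le> 1 / (1 - mag x)"
    using assms by (simp add: field_simps)
  also have "\<dots> = 1 + mag x / (1 - mag x)"
    using assms by (simp add: field_simps)
  also have "\<dots> \<le> 1 + mag x / (1 - d)"
    using assms by (intro add_left_mono divide_left_mono) auto
  also have "\<dots> \<le> exp (mag x / (1 - d))"
    by (rule exp_ge_add_one_self)
  finally show ?thesis
    by (simp add: u_def)
qed

lemma prod_one_minus_unit:
  "finite I \<Longrightarrow> (\<And>i. i \<in> I \<Longrightarrow> mag (x i) < 1) \<Longrightarrow> (\<Prod>i\<in>I. 1 - x i) dvd 1"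
  by (induction I rule: finite_induct) (auto intro!: unit_mult one_minus_unit)

lemma mag_rcp_prod_le:
  assumes "finite I" "\<And>i. i \<in> I \<Longrightarrow> mag (x i) \<le> d" "d < 1"
  shows "mag (1 div (\<Prod>i\<in>I. 1 - x i)) \<le> exp ((\<Sum>i\<in>I. mag (x i)) / (1 - d))"
  using assms(1,2)
proof (induction I rule: finite_induct)
  case empty
  show ?case
    using mag_rcp_one_minus_le[of 0 d] assms(3) by simp
next
  case (insert j I)
  have "mag (x i) < 1" if "i \<in> insert j I" for i
    using insert.prems[OF that] assms(3) by simp
  then have "1 div ((1 - x j) * (\<Prod>i\<in>I. 1 - x i)) = 1 div (1 - x j) * (1 div (\<Prod>i\<in>I. 1 - x i))"
    using insert.hyps by (intro rcp_mult one_minus_unit prod_one_minus_unit) auto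
  also have "mag \<dots> \<le> exp (mag (x j) / (1 - d)) * exp ((\<Sum>i\<in>I. mag (x i)) / (1 - d))"
    using insert assms(3) by (intro mag_mult_le_mono mag_rcp_one_minus_le) auto
  finally show ?case
    using insert.hyps by (simp add: add_divide_distrib exp_add)
qed

lemma sum_mag_geometric_le:
  assumes "mag q < 1"
  shows "(\<Sum>i\<in>{m..<n}. mag (A * q ^ i)) \<le> mag A * mag q ^ m / (1 - mag q)"
proof -
  have "(\<Sum>i\<in>{m..<n}. mag (A * q ^ i)) \<le> (\<Sum>i\<in>{m..<n}. mag A * mag q ^ i)"
    by (intro sum_mono mag_mult_le_mono mag_power_le) auto
  also have "\<dots> = mag A * (\<Sum>i\<in>{m..<n}. mag q ^ i)"
    by (simp add: sum_distrib_left)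
  also have "(\<Sum>i\<in>{m..<n}. mag q ^ i) \<le> mag q ^ m / (1 - mag q)"
  proof (cases "m \<le> n")
    case True
    then have "(\<Sum>i\<in>{m..<n}. mag q ^ i) * (1 - mag q) = mag q ^ m - mag q ^ n"
      by (induction n rule: dec_induct)
        (simp, simp only: sum.atLeastLessThan_Suc distrib_right, simp add: right_diff_distrib)
    then show ?thesis
      using assms zero_le_power[OF mag_nonneg, of q n] by (simp add: pos_le_divide_eq)
  qed (use assms in auto)
  finally show ?thesis
    by (simp add: mult_left_mono)
qed

lemma mag_interval_minus_1_le:
  assumes "mag q < 1"
  shows "mag ((\<Prod>i\<in>{m..<n}. 1 - A * q ^ i) - 1) \<le> exp (mag A * mag q ^ m / (1 - mag q)) - 1"
  using mag_prod_minus_1_le[of "{m..<n}" "\<lambda>i. A * q ^ i"] sum_mag_geometric_le[OF assms, of A m n]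
  by (auto elim!: order_trans)

lemma mag_interval_le:
  assumes "mag q < 1"
  shows "mag (\<Prod>i\<in>{m..<n}. 1 - A * q ^ i) \<le> exp (mag A / (1 - mag q))"
proof -
  have "mag A * mag q ^ m / (1 - mag q) \<le> mag A / (1 - mag q)"
    using assms by (intro divide_right_mono mult_left_le power_le_one) auto
  then show ?thesis
    using mag_prod_le[of "{m..<n}" "\<lambda>i. A * q ^ i"] sum_mag_geometric_le[OF assms, of A m n]
    by (auto elim!: order_trans)
qed

lemma exp_geometric_tendsto_1:
  assumes "mag q < 1" "filterlim f at_top F"
  shows "((\<lambda>N. exp (mag A * mag q ^ f N / (1 - mag q)) - 1) \<longlongrightarrow> 0) F"
proof -
  have "(\<lambda>m. mag q ^ m) \<longlonglongrightarrow> 0"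
    using assms(1) by (intro LIMSEQ_power_zero) simp
  then have "((\<lambda>N. mag q ^ f N) \<longlongrightarrow> 0) F"
    using assms(2) by (rule filterlim_compose)
  then have "((\<lambda>N. exp (mag A * mag q ^ f N / (1 - mag q)) - 1) \<longlongrightarrow> exp (mag A * 0 / (1 - mag q)) - 1) F"
    using assms(1) by (intro tendsto_intros) auto
  then show ?thesis
    by simp
qed

lemma interval_tendsto_1:
  assumes "mag q < 1" "filterlim f at_top F"
  shows "((\<lambda>N. \<Prod>i\<in>{f N..<g N}. 1 - A * q ^ i) \<longlongrightarrow> 1) F"
  unfolding tendsto_mag_iff
  by (rule tendsto_sandwich[OF _ _ tendsto_const exp_geometric_tendsto_1[OF assms, of A]])
    (intro always_eventually allI mag_nonneg mag_interval_minus_1_le assms)+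

lemma mag_qpoch_le: "mag q < 1 \<Longrightarrow> mag (qpoch A q n) \<le> exp (mag A / (1 - mag q))"
  using mag_interval_le[of q A 0 n] by (simp add: qpoch_def lessThan_atLeast0)

lemma mag_mult_power_le: "mag q < 1 \<Longrightarrow> mag (A * q ^ i) \<le> mag A"
  using mag_mult_le_mono[OF order_refl order_trans[OF mag_power_le power_le_one], of q A i] by simp

lemma qpoch_unit: "mag q < 1 \<Longrightarrow> mag A < 1 \<Longrightarrow> qpoch A q n dvd 1"
  unfolding qpoch_def
  by (intro prod_one_minus_unit order.strict_trans1[OF mag_mult_power_le]) auto

lemma mag_rcp_qpoch_le:
  assumes "mag q < 1" "mag A < 1"
  shows "mag (1 div qpoch A q n) \<le> exp (mag A / (1 - mag q) / (1 - mag A))"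
proof -
  have "(\<Sum>i<n. mag (A * q ^ i)) / (1 - mag A) \<le> mag A / (1 - mag q) / (1 - mag A)"
    using sum_mag_geometric_le[OF assms(1), of A 0 n] assms
    by (intro divide_right_mono) (auto simp: lessThan_atLeast0)
  then show ?thesis
    using mag_rcp_prod_le[of "{..<n}" "\<lambda>i. A * q ^ i" "mag A"] mag_mult_power_le[of q A] assms
    by (auto simp: qpoch_def elim!: order_trans)
qed

text \<open>
  The convention for infinite products requires the limit of the partial products to be nonzero.
  This holds because the reciprocals of the partial products are bounded.
\<close>

lemma
  assumes "mag q < 1" "mag A < 1"
  shows qpoch_tendsto_qpoch_inf: "(\<lambda>n. qpoch A q n) \<longlonglongrightarrow> qpoch_inf A q"
    and qpoch_inf_nonzero: "qpoch_inf A q \<noteq> 0"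
proof -
  define B where "B = exp (mag A / (1 - mag q))"
  define C where "C = exp (mag A / (1 - mag q) / (1 - mag A))"
  have "Cauchy (\<lambda>n. qpoch A q n)"
  proof (rule CauchyI')
    fix e :: real assume "e > 0"
    have "(\<lambda>m. B * (exp (mag A * mag q ^ m / (1 - mag q)) - 1)) \<longlonglongrightarrow> B * 0"
      using assms(1) by (intro tendsto_intros exp_geometric_tendsto_1 filterlim_ident)
    then have "\<forall>\<^sub>F m in sequentially. B * (exp (mag A * mag q ^ m / (1 - mag q)) - 1) < e"
      using \<open>e > 0\<close> by (intro order_tendstoD(2)[of _ "B * 0"]) auto
    then obtain M where M: "\<And>m. m \<ge> M \<Longrightarrow> B * (exp (mag A * mag q ^ m / (1 - mag q)) - 1) < e"
      by (auto simp: eventually_sequentially)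
    have "dist (qpoch A q m) (qpoch A q n) < e" if "m \<ge> M" "m < n" for m n
    proof -
      have "qpoch A q n - qpoch A q m = qpoch A q m * ((\<Prod>i\<in>{m..<n}. 1 - A * q ^ i) - 1)"
        using qpoch_mult_interval[of m n A q] that by (simp add: algebra_simps)
      also have "mag \<dots> \<le> B * (exp (mag A * mag q ^ m / (1 - mag q)) - 1)"
        unfolding B_def by (intro mag_mult_le_mono mag_qpoch_le mag_interval_minus_1_le assms)
      also have "\<dots> < e"
        using M that by simp
      finally show ?thesis
        by (metis dist_commute dist_eq_mag)
    qed
    then show "\<exists>M. \<forall>m\<ge>M. \<forall>n>m. dist (qpoch A q m) (qpoch A q n) < e"
      by blast
  qed
  then obtain L where L: "(\<lambda>n. qpoch A q n) \<longlonglongrightarrow> L"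
    by (meson Cauchy_convergent convergent_def)
  have "L \<noteq> 0"
  proof
    assume "L = 0"
    then have "(\<lambda>n. mag (qpoch A q n) * C) \<longlonglongrightarrow> 0 * C"
      using L by (intro tendsto_intros) (simp add: tendsto_mag_iff)
    then have "\<forall>\<^sub>F n in sequentially. mag (qpoch A q n) * C < 1"
      by (intro order_tendstoD(2)) auto
    then obtain n where "mag (qpoch A q n) * C < 1"
      by (auto simp: eventually_sequentially)
    moreover have "1 \<le> mag (qpoch A q n) * C"
    proof -
      have "1 = mag (qpoch A q n * (1 div qpoch A q n))"
        using mult_rcp[OF qpoch_unit[OF assms]] by simp
      also have "\<dots> \<le> mag (qpoch A q n) * C"
        unfolding C_def by (intro mag_mult_le_mono mag_rcp_qpoch_le assms) simp
      finally show ?thesis .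
    qed
    ultimately show False
      by simp
  qed
  have "(\<lambda>n. \<Prod>i\<le>n. 1 - A * q ^ i) \<longlonglongrightarrow> L"
    using LIMSEQ_Suc[OF L] by (simp only: qpoch_def lessThan_Suc_atMost)
  then have "(\<lambda>i. 1 - A * q ^ i) has_prod L"
    using \<open>L \<noteq> 0\<close> by (simp add: has_prod_def raw_has_prod_def)
  then have "qpoch_inf A q = L"
    unfolding qpoch_inf_def by (rule has_prod_unique[symmetric])
  then show "(\<lambda>n. qpoch A q n) \<longlonglongrightarrow> qpoch_inf A q" "qpoch_inf A q \<noteq> 0"
    using L \<open>L \<noteq> 0\<close> by auto
qed

lemma qpoch_inf_mult_minus:
  assumes "mag q < 1" "mag A < 1"
  shows "qpoch_inf A q * qpoch_inf (- A) q = qpoch_inf (A ^ 2) (q ^ 2)"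
proof (rule LIMSEQ_unique)
  show "(\<lambda>n. qpoch A q n * qpoch (- A) q n) \<longlonglongrightarrow> qpoch_inf A q * qpoch_inf (- A) q"
    using assms by (intro tendsto_mult qpoch_tendsto_qpoch_inf) auto
  have "qpoch A q n * qpoch (- A) q n = qpoch (A ^ 2) (q ^ 2) n" for n
  proof -
    have "qpoch A q n * qpoch (- A) q n = (\<Prod>i<n. (1 - A * q ^ i) * (1 - (- A) * q ^ i))"
      by (simp only: qpoch_def prod.distrib)
    also have "\<dots> = qpoch (A ^ 2) (q ^ 2) n"
      unfolding qpoch_def
      by (intro prod.cong) (simp_all add: algebra_simps power2_eq_square power_mult_distrib)
    finally show ?thesis .
  qed
  then show "(\<lambda>n. qpoch A q n * qpoch (- A) q n) \<longlonglongrightarrow> qpoch_inf (A ^ 2) (q ^ 2)"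
    using assms by (simp add: qpoch_tendsto_qpoch_inf mag_power_less_1)
qed

lemma qpoch_double_index_tendsto:
  assumes "mag q < 1" "mag A < 1"
  shows "(\<lambda>N. qpoch A q (2 * N)) \<longlonglongrightarrow> qpoch_inf A q"
  by (rule filterlim_compose[OF qpoch_tendsto_qpoch_inf[OF assms]])
    (rule filterlim_subseq, simp add: strict_mono_def)

lemma qpoch_inf_even_odd:
  assumes "mag q < 1" "mag A < 1"
  shows "qpoch_inf A q = qpoch_inf A (q ^ 2) * qpoch_inf (A * q) (q ^ 2)"
proof (rule LIMSEQ_unique)
  have "mag (A * q) < 1"
    using mag_mult_power_le[of q A 1] assms by simp
  then show "(\<lambda>n. qpoch A (q ^ 2) n * qpoch (A * q) (q ^ 2) n)
      \<longlonglongrightarrow> qpoch_inf A (q ^ 2) * qpoch_inf (A * q) (q ^ 2)"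
    using assms by (intro tendsto_mult qpoch_tendsto_qpoch_inf mag_power_less_1) auto
  have "qpoch A (q ^ 2) n * qpoch (A * q) (q ^ 2) n = qpoch A q (2 * n)" for n
    by (induction n) (simp_all add: qpoch_Suc mult_ac flip: power_mult)
  moreover note qpoch_double_index_tendsto[OF assms]
  ultimately show "(\<lambda>n. qpoch A (q ^ 2) n * qpoch (A * q) (q ^ 2) n) \<longlonglongrightarrow> qpoch_inf A q"
    by simp
qed

section \<open>The truncated triple sum and the truncated theta series\<close>

lemma qpoch_self_unit: "mag p < 1 \<Longrightarrow> qpoch p p k dvd 1"
  by (rule qpoch_unit)

lemma unit_nonzero: "u dvd 1 \<Longrightarrow> u \<noteq> (0::'a::idom_divide)"
  by auto

lemma qpoch_minus_1_Suc: "qpoch (- 1) p (Suc k) = (1 + 1) * qpoch (- p) p k"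
  using qpoch_add[of "- 1" p 1 k] by (simp add: qpoch_Suc)

lemma qpoch_minus_1_unit: "mag p < 1 \<Longrightarrow> qpoch (- 1) p k dvd 1"
  by (cases k, simp, simp only: qpoch_minus_1_Suc, intro unit_mult two_dvd_1 qpoch_unit) simp_all

text \<open>
  Dividing \<open>qbinom_sum_eq_qpoch_minus_1\<close> by its right-hand side shows that the terms of the triple
  sum with \<open>j + r = m\<close> contribute, apart from factors that do not involve \<open>j\<close>, exactly 1.
\<close>
lemma inner_sum_normalised:
  fixes p :: "'a::complete_normed_domain"
  assumes p: "mag p < 1" "p \<noteq> 0" and "m > 0"
  shows "(\<Sum>j\<le>m. p ^ (m - j choose 2) * qpoch p p (m + j - 1) * (1 - p ^ (2 * m)) *
           ((1 div qpoch p p (m - j)) * (1 div qpoch p p j) * (1 div qpoch (- 1) p (Suc j)))) = 1"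
    (is "(\<Sum>j\<le>m. ?t j) = 1")
proof -
  let ?f = "qpoch p p" and ?h = "qpoch (- 1) p" and ?i = "\<lambda>k. 1 div qpoch p p k"
  let ?R = "\<lambda>j. \<Prod>i\<in>{j..<m}. 1 + p ^ Suc i"
  obtain l where m: "m = Suc l"
    using \<open>m > 0\<close> by (cases m) auto
  have summand: "?f m * ?h (Suc m) * ?t j =
      ?f l * (1 - p ^ (2 * m)) * (qbinom p m j * (p ^ (m - j choose 2) * qpoch (p ^ m) p j * ?R j))"
    if "j \<le> m" for j
  proof -
    have "?R j = (\<Prod>i\<in>{Suc j..<Suc m}. 1 - (- 1) * p ^ i)"
      by (subst prod.shift_bounds_Suc_ivl) simp
    also have "\<dots> = ?h (Suc m) * (1 div ?h (Suc j))"
      using that p by (intro qpoch_eq_rcp qpoch_minus_1_unit) auto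
    finally have R: "?R j = \<dots>" .
    have f: "?f (m + j - 1) = ?f l * qpoch (p ^ m) p j"
      using qpoch_add[of p p l j] by (simp add: m)
    show ?thesis
      unfolding R f qbinom_eq[OF qpoch_self_unit[OF p(1)] that] by (simp only: mult_ac)
  qed
  have "?f m * ?h (Suc m) * (\<Sum>j\<le>m. ?t j) = ?f l * (1 - p ^ (2 * m)) * ?h m"
    unfolding qbinom_sum_eq_qpoch_minus_1[OF p(2), of m, symmetric] sum_distrib_left
    by (intro sum.cong refl summand) simp
  also have "\<dots> = ?f m * ?h (Suc m)"
  proof -
    have "1 - p ^ (2 * m) = (1 - p ^ m) * (1 - (- 1) * p ^ m)"
      by (simp add: algebra_simps mult_2_right flip: power_add)
    also have "p ^ m = p * p ^ l"
      by (simp add: m)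
    finally have "1 - p ^ (2 * m) = (1 - p * p ^ l) * (1 - (- 1) * p ^ m)"
      by (simp add: m)
    then show ?thesis
      by (simp only: m qpoch_Suc mult_ac)
  qed
  finally show ?thesis
    using unit_nonzero[OF qpoch_self_unit[OF p(1)], of m]
      unit_nonzero[OF qpoch_minus_1_unit[OF p(1)], of "Suc m"] by simp
qed

text \<open>
  The series \<open>\<Sum>k\<in>\<int>. q ^ (3 * k\<^sup>2 + k)\<close> with the terms of index \<open>m\<close> and \<open>- m\<close> put together.
\<close>
definition theta_term :: "'a::comm_ring_1 \<Rightarrow> nat \<Rightarrow> 'a" where
  "theta_term q m = (if m = 0 then 1 else q ^ (3 * m ^ 2 - m) * (1 + q ^ (2 * m)))"

text \<open>
  The value at \<open>m = 0\<close> is the one that makes \<open>triple_term_eq\<close> hold there too: the denominator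
  \<open>(- 1; p)\<^sub>1 = 2\<close> cancels the numerator \<open>1 + q ^ 0\<close>, which \<open>theta_term q 0 = 1\<close> leaves out.
\<close>
definition inner_term :: "'a::idom_divide \<Rightarrow> nat \<Rightarrow> nat \<Rightarrow> 'a" where
  "inner_term p m j = (if m = 0 then 1 else
     p ^ (m - j choose 2) * qpoch p p (m + j - 1) * (1 - p ^ (2 * m)) *
           ((1 div qpoch p p (m - j)) * (1 div qpoch p p j) * (1 div qpoch (- 1) p (Suc j))))"

lemma sum_inner_term:
  "mag p < 1 \<Longrightarrow> p \<noteq> 0 \<Longrightarrow> (\<Sum>j\<le>m. inner_term p m j) = 1"
  using inner_sum_normalised[of p m] by (cases "m = 0") (simp_all add: inner_term_def)

lemma triple_exponent_eq:
  "triple_exponent n j r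
     = 3 * (n ^ 2 + 2 * (j + r) * n) + (3 * (j + r) ^ 2 - (j + r)) + 3 * (r choose 2)"
proof -
  have "(9 * r ^ 2 - 5 * r) div 2 = 9 * (r choose 2) + 2 * r"
    unfolding power2_eq_square square_eq_choose_two by simp
  moreover have "3 * j ^ 2 - j = 6 * (j choose 2) + 2 * j"
    unfolding power2_eq_square square_eq_choose_two by simp
  moreover have "3 * (j + r) ^ 2 - (j + r) = 6 * (j + r choose 2) + 2 * (j + r)"
    unfolding power2_eq_square square_eq_choose_two by simp
  ultimately show ?thesis
    by (simp add: triple_exponent_def add_choose_two algebra_simps)
qed

lemma div_eq_mult_rcp:
  fixes u :: "'a::idom_divide"
  assumes "u dvd 1"
  shows "x div u = x * (1 div u)"
proof -
  have "(x * (1 div u)) * u = x * (u * (1 div u))"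
    by (simp only: mult_ac)
  also have "\<dots> = x"
    unfolding mult_rcp[OF assms] by simp
  finally show ?thesis
    using nonzero_mult_div_cancel_right[OF unit_nonzero[OF assms], of "x * (1 div u)"] by (simp only:)
qed

text \<open>
  With \<open>m = j + r\<close> the summand factors: one part involves \<open>n\<close> and \<open>m\<close>, one \<open>m\<close> alone, and one \<open>m\<close>
  and \<open>j\<close>. For fixed \<open>m\<close> the sums over \<open>n\<close> and over \<open>j\<close> are therefore independent.
\<close>
lemma triple_term_eq:
  fixes q :: "'a::complete_normed_domain"
  assumes q: "mag q < 1" and "j \<le> m"
  defines "p \<equiv> q ^ 3"
  shows "triple_term q n j (m - j) = p ^ (n ^ 2 + 2 * m * n)
           * ((1 div qpoch p p n) * (1 div qpoch p p (n + 2 * m)))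
           * theta_term q m * inner_term p m j"
proof -
  let ?i = "\<lambda>k. 1 div qpoch p p k"
  have p: "mag p < 1"
    unfolding p_def using q by (simp add: mag_power_less_1)
  note units = unit_mult qpoch_self_unit[OF p] qpoch_minus_1_unit[OF p]
  define X where "X = q ^ triple_exponent n j (m - j)
        * (if m - j = 0 \<and> j = 0 then 1
           else qpoch (q ^ 3) (q ^ 3) (2 * j + (m - j) - 1) * (1 - q ^ (6 * (m - j) + 6 * j)))
        * (1 + q ^ (2 * (m - j) + 2 * j))"
  have "triple_term q n j (m - j) = X div (qpoch p p n * qpoch p p (m - j) * qpoch p p j
        * qpoch (- 1) p (Suc j) * qpoch p p (n + 2 * m))"
    using \<open>j \<le> m\<close> unfolding triple_term_def X_def p_def by (simp add: algebra_simps)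
  also have "\<dots> = X * (1 div (qpoch p p n * qpoch p p (m - j) * qpoch p p j
        * qpoch (- 1) p (Suc j) * qpoch p p (n + 2 * m)))"
    by (intro div_eq_mult_rcp units)
  also have "1 div (qpoch p p n * qpoch p p (m - j) * qpoch p p j
        * qpoch (- 1) p (Suc j) * qpoch p p (n + 2 * m))
      = ?i n * ?i (m - j) * ?i j * (1 div qpoch (- 1) p (Suc j)) * ?i (n + 2 * m)"
    by (simp add: rcp_mult units)
  finally have *: "triple_term q n j (m - j) = X * \<dots>" .
  have e: "q ^ triple_exponent n j (m - j)
      = p ^ (n ^ 2 + 2 * m * n) * q ^ (3 * m ^ 2 - m) * p ^ (m - j choose 2)"
  proof -
    have "j + (m - j) = m"
      using \<open>j \<le> m\<close> by simp
    then show ?thesis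
      unfolding triple_exponent_eq p_def by (simp only: power_add distrib_left flip: power_mult)
  qed
  show ?thesis
  proof (cases "m = 0")
    case True
    have "X = p ^ (n ^ 2) * (1 + 1)"
      using e True \<open>j \<le> m\<close> by (simp add: X_def)
    moreover have "qpoch (- 1) p (Suc 0) = 1 + 1"
      by (simp add: qpoch_Suc)
    moreover have "?i 0 = 1"
      using mult_rcp[OF qpoch_self_unit[OF p, of 0]] by simp
    moreover have "(1 + 1) * (1 div (1 + 1)) = (1::'a)"
      by (rule mult_rcp[OF two_dvd_1])
    ultimately show ?thesis
      using True \<open>j \<le> m\<close> unfolding *
      by (simp add: theta_term_def inner_term_def mult_ac del: one_add_one)
  next
    case False
    have a: "2 * j + (m - j) - 1 = m + j - 1" "6 * (m - j) + 6 * j = 3 * (2 * m)"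
        "2 * (m - j) + 2 * j = 2 * m" "\<not> (m - j = 0 \<and> j = 0)"
      using \<open>j \<le> m\<close> False by auto
    have "q ^ (3 * (2 * m)) = p ^ (2 * m)"
      unfolding p_def by (rule power_mult)
    moreover have "X = q ^ triple_exponent n j (m - j)
        * (qpoch p p (m + j - 1) * (1 - q ^ (3 * (2 * m)))) * (1 + q ^ (2 * m))"
      unfolding X_def p_def using a(4) by (simp only: a if_False)
    ultimately have X: "X = p ^ (n ^ 2 + 2 * m * n) * q ^ (3 * m ^ 2 - m) * p ^ (m - j choose 2)
        * (qpoch p p (m + j - 1) * (1 - p ^ (2 * m))) * (1 + q ^ (2 * m))"
      by (simp only: e)
    show ?thesis
      unfolding * X theta_term_def inner_term_def using False by (simp only: mult_ac if_False)
  qed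
qed

definition truncation :: "nat \<Rightarrow> (nat \<times> nat \<times> nat) set" where
  "truncation N = {(n, j, r). n + j + r \<le> N}"

lemma sum_truncation:
  "(\<Sum>(n, j, r)\<in>truncation N. g n j r) = (\<Sum>m\<le>N. \<Sum>n\<le>N - m. \<Sum>j\<le>m. g n j (m - j))"
proof -
  have "(\<Sum>(n, j, r)\<in>truncation N. g n j r)
      = (\<Sum>(m, n, j)\<in>(SIGMA m:{..N}. {..N - m} \<times> {..m}). g n j (m - j))"
    by (rule sum.reindex_bij_witness[of _ "\<lambda>(m, n, j). (n, j, m - j)" "\<lambda>(n, j, r). (j + r, n, j)"])
      (auto simp: truncation_def)
  also have "\<dots> = (\<Sum>m\<le>N. \<Sum>(n, j)\<in>{..N - m} \<times> {..m}. g n j (m - j))"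
    by (subst sum.Sigma) (auto simp: case_prod_unfold)
  finally show ?thesis
    by (simp add: sum.cartesian_product)
qed

text \<open>
  The factors \<open>(p; p)\<^sub>N / (p; p)\<^sub>N\<^sub>-\<^sub>n\<^sub>-\<^sub>j\<^sub>-\<^sub>r\<close> tend to 1 and are chosen such that the sum over \<open>n\<close> becomes
  the truncated Durfee identity at \<open>N - m\<close>. Hence there is an exact identity for every \<open>N\<close>, and no
  rearrangement of infinite sums is required.
\<close>
lemma finite_triple_sum:
  fixes q :: "'a::complete_normed_domain"
  assumes q: "mag q < 1" "q \<noteq> 0"
  defines "p \<equiv> q ^ 3"
  shows "(\<Sum>(n, j, r)\<in>truncation N. triple_term q n j r
            * (qpoch p p N * (1 div qpoch p p (N - (n + j + r)))))
         = qpoch p p N * (\<Sum>m\<le>N. theta_term q m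
            * ((1 div qpoch p p (N - m)) * (1 div qpoch p p (N + m))))"
proof -
  let ?i = "\<lambda>k. 1 div qpoch p p k"
  have p: "mag p < 1" "p \<noteq> 0"
    unfolding p_def using q by (simp_all add: mag_power_less_1)
  have "(\<Sum>(n, j, r)\<in>truncation N. triple_term q n j r * (qpoch p p N * ?i (N - (n + j + r))))
      = (\<Sum>m\<le>N. \<Sum>n\<le>N - m. \<Sum>j\<le>m. qpoch p p N * theta_term q m *
          (p ^ (n ^ 2 + 2 * m * n) * (?i n * ?i (n + 2 * m) * ?i (N - m - n)) * inner_term p m j))"
    unfolding sum_truncation
  proof (intro sum.cong refl)
    fix m n j :: nat assume "j \<in> {..m}"
    then have "N - (n + j + (m - j)) = N - m - n" and "j \<le> m"
      by auto
    then show "triple_term q n j (m - j) * (qpoch p p N * ?i (N - (n + j + (m - j))))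
        = qpoch p p N * theta_term q m *
          (p ^ (n ^ 2 + 2 * m * n) * (?i n * ?i (n + 2 * m) * ?i (N - m - n)) * inner_term p m j)"
      by (simp only: triple_term_eq[OF q(1), folded p_def] mult_ac)
  qed
  also have "\<dots> = (\<Sum>m\<le>N. qpoch p p N * theta_term q m *
          ((\<Sum>n\<le>N - m. p ^ (n ^ 2 + 2 * m * n) * (?i n * ?i (n + 2 * m) * ?i (N - m - n)))
            * (\<Sum>j\<le>m. inner_term p m j)))"
    by (simp only: sum_distrib_left[symmetric] sum_distrib_right[symmetric])
  also have "\<dots> = (\<Sum>m\<le>N. qpoch p p N * theta_term q m * (?i (N - m) * ?i (N + m)))"
  proof (intro sum.cong refl)
    fix m assume "m \<in> {..N}"
    then have "N - m + 2 * m = N + m"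
      by auto
    with finite_durfee[OF qpoch_self_unit[OF p(1)], where M = "N - m" and e = "2 * m"]
    have "(\<Sum>n\<le>N - m. p ^ (n ^ 2 + 2 * m * n) * (?i n * ?i (n + 2 * m) * ?i (N - m - n)))
        = ?i (N - m) * ?i (N + m)"
      by (simp only:)
    then show "qpoch p p N * theta_term q m *
          ((\<Sum>n\<le>N - m. p ^ (n ^ 2 + 2 * m * n) * (?i n * ?i (n + 2 * m) * ?i (N - m - n)))
            * (\<Sum>j\<le>m. inner_term p m j)) = qpoch p p N * theta_term q m * (?i (N - m) * ?i (N + m))"
      by (simp only: sum_inner_term[OF p] mult_1_right)
  qed
  finally show ?thesis
    by (simp add: sum_distrib_left mult.assoc)
qed

text \<open>
  The weights agree with those in \<open>finite_triple_sum\<close> except for the base, \<open>q ^ 6\<close> instead of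
  \<open>q ^ 3\<close>. For this base the theta series is a triple product, with \<open>z = q\<^sup>2\<close> and \<open>w = q ^ 4\<close>.
\<close>
lemma finite_theta_product:
  fixes q :: "'a::complete_normed_domain"
  assumes q: "mag q < 1" "q \<noteq> 0"
  defines "p \<equiv> q ^ 6"
  shows "qpoch p p (2 * N) * (\<Sum>m\<le>N. theta_term q m
            * ((1 div qpoch p p (N - m)) * (1 div qpoch p p (N + m))))
         = qpoch (- (q ^ 2)) p N * qpoch (- (q ^ 4)) p N"
proof -
  let ?i = "\<lambda>k. 1 div qpoch p p k"
  have p: "mag p < 1" "p \<noteq> 0"
    unfolding p_def using q by (simp_all add: mag_power_less_1)
  have "q ^ 2 * q ^ 4 = p"
    by (simp add: p_def flip: power_add)
  from finite_jacobi_triple_product[OF this p(2), of N]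
  have "qpoch (- (q ^ 2)) p N * qpoch (- (q ^ 4)) p N =
      (\<Sum>m\<le>N. p ^ (m choose 2) * (if m = 0 then qbinom p (2 * N) N else
        (q ^ 2) ^ m * qbinom p (2 * N) (N + m) + (q ^ 4) ^ m * qbinom p (2 * N) (N - m)))"
    by simp
  also have "\<dots> = (\<Sum>m\<le>N. qpoch p p (2 * N) * (theta_term q m * (?i (N - m) * ?i (N + m))))"
  proof (intro sum.cong refl)
    fix m assume "m \<in> {..N}"
    then have le: "N + m \<le> 2 * N" "N - m \<le> 2 * N" "2 * N - (N + m) = N - m" "2 * N - (N - m) = N + m"
      by auto
    have exps: "3 * m ^ 2 - m = 6 * (m choose 2) + 2 * m"
      unfolding power2_eq_square square_eq_choose_two by simp
    have "p ^ (m choose 2) * (q ^ 2) ^ m = q ^ (3 * m ^ 2 - m)"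
         "p ^ (m choose 2) * (q ^ 4) ^ m = q ^ (3 * m ^ 2 - m) * q ^ (2 * m)"
      unfolding exps p_def by (simp_all add: add_ac flip: power_mult power_add)
    then have "p ^ (m choose 2) * ((q ^ 2) ^ m * Z + (q ^ 4) ^ m * Z) = q ^ (3 * m ^ 2 - m) * (1 + q ^ (2 * m)) * Z" for Z
      by (simp add: distrib_left distrib_right flip: mult.assoc)
    note * = this[of "qpoch p p (2 * N) * (?i (N - m) * ?i (N + m))"]
    have A: "qbinom p (2 * N) (N + m) = qpoch p p (2 * N) * (?i (N - m) * ?i (N + m))"
         "qbinom p (2 * N) (N - m) = qpoch p p (2 * N) * (?i (N - m) * ?i (N + m))"
      unfolding qbinom_eq[OF qpoch_self_unit[OF p(1)] le(1)] qbinom_eq[OF qpoch_self_unit[OF p(1)] le(2)] le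
      by (simp_all only: mult_ac)
    show "p ^ (m choose 2) * (if m = 0 then qbinom p (2 * N) N else
        (q ^ 2) ^ m * qbinom p (2 * N) (N + m) + (q ^ 4) ^ m * qbinom p (2 * N) (N - m))
      = qpoch p p (2 * N) * (theta_term q m * (?i (N - m) * ?i (N + m)))"
    proof (cases "m = 0")
      case True
      then show ?thesis
        using A(1) by (simp add: theta_term_def)
    next
      case False
      then show ?thesis
        unfolding A theta_term_def using * by (simp only: if_False mult_ac)
    qed
  qed
  finally show ?thesis
    by (simp add: sum_distrib_left)
qed

section \<open>Passage to the limit\<close>

lemma le_three_squares_minus: "m \<le> 3 * m ^ 2 - (m::nat)"
  unfolding power2_eq_square square_eq_choose_two by simp

lemma triple_exponent_ge: "triple_exponent n j r \<ge> n + j + r"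
proof -
  have "n \<le> 3 * (n ^ 2 + 2 * (j + r) * n)"
    by (cases n) (auto simp: power2_eq_square)
  then show ?thesis
    using le_three_squares_minus[of "j + r"] unfolding triple_exponent_eq by simp
qed

lemma mag_power_le_power:
  assumes "mag q \<le> 1" "n \<le> k"
  shows "mag (q ^ k) \<le> mag q ^ n"
  using assms by (intro order_trans[OF mag_power_le power_decreasing]) auto

lemma summable_on_product:
  fixes f :: "'a \<Rightarrow> real" and g :: "'b \<Rightarrow> real"
  assumes "f summable_on UNIV" "g summable_on UNIV" "\<And>x. f x \<ge> 0" "\<And>y. g y \<ge> 0"
  shows "(\<lambda>(x, y). f x * g y) summable_on UNIV"
  unfolding UNIV_Times_UNIV[symmetric]
  using assms by (intro summable_on_SigmaI[where g = "\<lambda>x. f x * infsum g UNIV"])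
    (auto intro!: has_sum_cmult_right summable_on_cmult_left has_sum_infsum)

lemma geometric_summable_on:
  assumes "0 \<le> \<rho>" "\<rho> < (1::real)"
  shows "(\<lambda>n. \<rho> ^ n) summable_on UNIV"
  using assms by (intro norm_summable_imp_summable_on) (simp add: summable_geometric norm_power)

lemma geometric_summable_on_triples:
  assumes "0 \<le> \<rho>" "\<rho> < (1::real)"
  shows "(\<lambda>(n, j, r). \<rho> ^ (n + j + r)) summable_on UNIV"
proof -
  have "(\<lambda>(n, y). \<rho> ^ n * (case y of (j, r) \<Rightarrow> \<rho> ^ j * \<rho> ^ r)) summable_on UNIV"
    using assms by (intro summable_on_product geometric_summable_on) auto
  then show ?thesis
    by (simp add: power_add case_prod_unfold mult.assoc)
qed

lemma theta_term_summable:
  assumes "mag q < 1"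
  shows "(\<lambda>m. mag (theta_term q m)) summable_on UNIV"
proof (rule summable_on_comparison_test)
  show "(\<lambda>m. mag q ^ m * 2) summable_on UNIV"
    using assms by (intro summable_on_cmult_left geometric_summable_on) auto
  show "mag (theta_term q m) \<le> mag q ^ m * 2" for m
  proof (cases "m = 0")
    case False
    have "mag (q ^ (3 * m ^ 2 - m)) \<le> mag q ^ m"
      using assms by (intro mag_power_le_power le_three_squares_minus) simp
    moreover have "mag (1 + q ^ (2 * m)) \<le> 2"
      using mag_add_le[of 1 "q ^ (2 * m)"] mag_power_less_1[OF assms, of "2 * m"] False by simp
    ultimately show ?thesis
      using False by (auto simp: theta_term_def intro!: mag_mult_le_mono)
  qed (simp add: theta_term_def)
qed simp

text \<open>
  Apart from the power of \<open>q\<close>, all factors of the summand are bounded uniformly in the indices, and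
  the exponent is at least \<open>n + j + r\<close>.
\<close>
lemma triple_term_summable:
  fixes q :: "'a::complete_normed_domain"
  assumes q: "mag q < 1"
  shows "(\<lambda>(n, j, r). mag (triple_term q n j r)) summable_on UNIV"
proof -
  define p where "p = q ^ 3"
  have p: "mag p < 1"
    unfolding p_def using q by (simp add: mag_power_less_1)
  note units = unit_mult qpoch_self_unit[OF p] qpoch_minus_1_unit[OF p]
  let ?i = "\<lambda>k. 1 div qpoch p p k"
  define B where "B = exp (mag p / (1 - mag p))"
  define C where "C = exp (mag p / (1 - mag p) / (1 - mag p))"
  define D where "D = mag (1 div (1 + 1 :: 'a)) * C"
  define K where "K = (1 + B * 2) * 2 * (C * C * C * D * C)"
  have [simp]: "B \<ge> 0" "C \<ge> 0" "D \<ge> 0"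
    by (simp_all add: B_def C_def D_def)
  have h: "mag (1 div qpoch (- 1) p (j + 1)) \<le> D" for j
  proof -
    have "1 div qpoch (- 1) p (j + 1) = (1 div (1 + 1)) * (1 div qpoch (- p) p j)"
      using p by (simp only: qpoch_minus_1_Suc Suc_eq_plus1[symmetric])
        (intro rcp_mult two_dvd_1 qpoch_unit, auto)
    also have "mag \<dots> \<le> D"
      unfolding D_def C_def using mag_rcp_qpoch_le[of p "- p" j] p
      by (intro mag_mult_le_mono) auto
    finally show ?thesis .
  qed
  have f: "mag (qpoch p p k) \<le> B" and i: "mag (?i k) \<le> C" for k
    unfolding B_def C_def by (intro mag_qpoch_le mag_rcp_qpoch_le p)+
  have le2: "mag (1 - q ^ k) \<le> 2" "mag (1 + q ^ k) \<le> 2" for k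
    using mag_diff_le[of 1 "q ^ k"] mag_add_le[of 1 "q ^ k"] mag_power_le[of q k]
      power_le_one[of "mag q" k] q by simp_all
  have bound: "mag (triple_term q n j r) \<le> mag q ^ (n + j + r) * K" for n j r
  proof -
    define X where "X = (if r = 0 \<and> j = 0 then 1
           else qpoch p p (2 * j + r - 1) * (1 - q ^ (6 * r + 6 * j)))"
    have "mag X \<le> 1 + B * 2"
      unfolding X_def by (auto intro!: order_trans[OF mag_mult_le_mono[OF f le2(1)]])
    have "triple_term q n j r = q ^ triple_exponent n j r * X * (1 + q ^ (2 * r + 2 * j))
        * (1 div (qpoch p p n * qpoch p p r * qpoch p p j
        * qpoch (- 1) p (j + 1) * qpoch p p (n + 2 * r + 2 * j)))"
      unfolding triple_term_def X_def p_def[symmetric] by (intro div_eq_mult_rcp units)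
    also have "\<dots> = q ^ triple_exponent n j r * (X * (1 + q ^ (2 * r + 2 * j))
        * (?i n * ?i r * ?i j * (1 div qpoch (- 1) p (j + 1)) * ?i (n + 2 * r + 2 * j)))"
      by (simp add: rcp_mult units mult.assoc)
    also have "mag \<dots> \<le> mag q ^ (n + j + r) * K"
      unfolding K_def
    proof (intro mag_mult_le_mono h i le2 \<open>mag X \<le> 1 + B * 2\<close>)
      show "mag (q ^ triple_exponent n j r) \<le> mag q ^ (n + j + r)"
        using q by (intro mag_power_le_power triple_exponent_ge) simp
    qed
    finally show ?thesis .
  qed
  show ?thesis
  proof (rule summable_on_comparison_test)
    show "(\<lambda>x. (case x of (n, j, r) \<Rightarrow> mag q ^ (n + j + r)) * K) summable_on UNIV"
      using q by (intro summable_on_cmult_left geometric_summable_on_triples) auto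
  qed (auto simp: bound)
qed

text \<open>
  In the limit the base \<open>p\<close> of the weights disappears. This connects \<open>finite_triple_sum\<close>, of base
  \<open>q ^ 3\<close>, with \<open>finite_theta_product\<close>, of base \<open>q ^ 6\<close>.
\<close>
lemma theta_limit:
  fixes q p :: "'a::complete_normed_domain"
  assumes q: "mag q < 1" and p: "mag p < 1"
  shows "(\<lambda>N. qpoch p p N * qpoch p p (2 * N) * (\<Sum>m\<le>N. theta_term q m
            * ((1 div qpoch p p (N - m)) * (1 div qpoch p p (N + m)))))
         \<longlonglongrightarrow> infsum (theta_term q) UNIV"
proof -
  \<comment> \<open>the weights without division: quotients of q-Pochhammer symbols are products over intervals\<close>
  define c where "c N m = (\<Prod>i\<in>{N - m..<N}. 1 - p * p ^ i) * (\<Prod>i\<in>{N + m..<2 * N}. 1 - p * p ^ i)"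
    for N m
  have "(\<lambda>N. \<Sum>m\<le>N. theta_term q m * c N m) \<longlonglongrightarrow> infsum (theta_term q) UNIV"
  proof (rule tannery)
    show "(\<lambda>m. mag (theta_term q m)) summable_on UNIV"
      by (rule theta_term_summable[OF q])
    show "\<forall>\<^sub>F N in sequentially. m \<in> {..N}" for m
      using eventually_ge_at_top[of m] by simp
    show "mag (c N m) \<le> exp (mag p / (1 - mag p)) * exp (mag p / (1 - mag p))" for N m
      unfolding c_def by (intro mag_mult_le_mono mag_interval_le p)
    show "(\<lambda>N. c N m) \<longlonglongrightarrow> 1" for m
    proof -
      have "(\<lambda>N. c N m) \<longlonglongrightarrow> 1 * 1"
        unfolding c_def
        by (intro tendsto_mult interval_tendsto_1 p filterlim_minus_const_nat_at_top
            filterlim_add_const_nat_at_top)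
      then show ?thesis
        by simp
    qed
  qed auto
  also have "(\<lambda>N. \<Sum>m\<le>N. theta_term q m * c N m) =
      (\<lambda>N. qpoch p p N * qpoch p p (2 * N) * (\<Sum>m\<le>N. theta_term q m
            * ((1 div qpoch p p (N - m)) * (1 div qpoch p p (N + m)))))"
  proof (intro ext, unfold sum_distrib_left, intro sum.cong refl)
    fix N m :: nat assume "m \<in> {..N}"
    then have "c N m = (qpoch p p N * (1 div qpoch p p (N - m)))
        * (qpoch p p (2 * N) * (1 div qpoch p p (N + m)))"
      unfolding c_def by (intro arg_cong2[of _ _ _ _ "(*)"] qpoch_eq_rcp qpoch_self_unit p) auto
    then show "theta_term q m * c N m = qpoch p p N * qpoch p p (2 * N) *
        (theta_term q m * ((1 div qpoch p p (N - m)) * (1 div qpoch p p (N + m))))"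
      by (simp only: mult_ac)
  qed
  finally show ?thesis .
qed

lemma triple_limit:
  fixes q :: "'a::complete_normed_domain"
  assumes q: "mag q < 1"
  defines "p \<equiv> q ^ 3"
  shows "(\<lambda>N. \<Sum>(n, j, r)\<in>truncation N. triple_term q n j r
            * (qpoch p p N * (1 div qpoch p p (N - (n + j + r)))))
         \<longlonglongrightarrow> 1 + (\<Sum>\<^sub>\<infinity>(n, j, r)\<in>UNIV - {(0, 0, 0)}. triple_term q n j r)"
proof -
  have p: "mag p < 1"
    unfolding p_def using q by (simp add: mag_power_less_1)
  let ?T = "\<lambda>(n, j, r). triple_term q n j r"
  define c where "c N x = (case x of (n, j, r) \<Rightarrow> qpoch p p N * (1 div qpoch p p (N - (n + j + r))))"
    for N x
  define c' where "c' N x = (case x of (n, j, r) \<Rightarrow> \<Prod>i\<in>{N - (n + j + r)..<N}. 1 - p * p ^ i)" for N x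
  have c_eq: "c N x = c' N x" for N x
    unfolding c_def c'_def
    by (auto split: prod.split intro!: qpoch_eq_rcp[symmetric] qpoch_self_unit p)
  have finite: "finite (truncation N)" for N
    by (rule finite_subset[of _ "{..N} \<times> {..N} \<times> {..N}"]) (auto simp: truncation_def)
  have "(\<lambda>N. \<Sum>x\<in>truncation N - {(0, 0, 0)}. ?T x * c' N x) \<longlonglongrightarrow> infsum ?T (UNIV - {(0, 0, 0)})"
  proof (rule tannery)
    show "(\<lambda>x. mag (?T x)) summable_on UNIV - {(0, 0, 0)}"
      using summable_on_subset_banach[OF triple_term_summable[OF q]] by (simp add: case_prod_unfold)
    show "\<forall>\<^sub>F N in sequentially. x \<in> truncation N - {(0, 0, 0)}" if "x \<in> UNIV - {(0, 0, 0)}" for x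
      using that by (cases x) (auto simp: truncation_def eventually_ge_at_top)
    show "mag (c' N x) \<le> exp (mag p / (1 - mag p))" for N x
      unfolding c'_def by (auto split: prod.split intro!: mag_interval_le p)
    show "(\<lambda>N. c' N x) \<longlonglongrightarrow> 1" for x
      unfolding c'_def
      by (cases x) (auto intro!: interval_tendsto_1 p filterlim_minus_const_nat_at_top)
  qed (use finite in auto)
  then have "(\<lambda>N. 1 + (\<Sum>x\<in>truncation N - {(0, 0, 0)}. ?T x * c N x))
      \<longlonglongrightarrow> 1 + infsum ?T (UNIV - {(0, 0, 0)})"
    unfolding c_eq by (intro tendsto_add tendsto_const)
  also have "(\<lambda>N. 1 + (\<Sum>x\<in>truncation N - {(0, 0, 0)}. ?T x * c N x))
      = (\<lambda>N. \<Sum>(n, j, r)\<in>truncation N. triple_term q n j r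
            * (qpoch p p N * (1 div qpoch p p (N - (n + j + r)))))"
  proof
    fix N
    have "triple_term q 0 0 0 = 1"
    proof -
      have "(1 + 1 :: 'a) div (1 + 1) = 1"
        by (rule trans[OF div_eq_mult_rcp[OF two_dvd_1] mult_rcp[OF two_dvd_1]])
      then show ?thesis
        by (simp add: triple_term_def qpoch_Suc triple_exponent_def)
    qed
    moreover have "c N (0, 0, 0) = 1"
      by (simp add: c_eq c'_def)
    moreover have "(\<Sum>x\<in>truncation N. ?T x * c N x)
        = ?T (0, 0, 0) * c N (0, 0, 0) + (\<Sum>x\<in>truncation N - {(0, 0, 0)}. ?T x * c N x)"
      by (rule sum.remove[OF finite]) (simp add: truncation_def)
    ultimately show "1 + (\<Sum>x\<in>truncation N - {(0, 0, 0)}. ?T x * c N x)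
        = (\<Sum>(n, j, r)\<in>truncation N. triple_term q n j r
            * (qpoch p p N * (1 div qpoch p p (N - (n + j + r)))))"
      by (simp add: c_def case_prod_unfold)
  qed
  finally show ?thesis .
qed

text \<open>
  Both limits of the theta series give \<open>S * (q\<^sup>3; q\<^sup>3) = (q\<^sup>6; q\<^sup>6) * (- q\<^sup>2; q\<^sup>6) * (- q\<^sup>4; q\<^sup>6)\<close> for the
  triple sum \<open>S\<close>. What remains is to rewrite infinite products to base \<open>q ^ 12\<close> by separating the
  factors of even and odd index and by \<open>(1 - x) * (1 + x) = 1 - x\<^sup>2\<close>.
\<close>
lemma triple_sum_times_product:
  fixes q :: "'a::complete_normed_domain"
  assumes q: "mag q < 1" "q \<noteq> 0"
  shows "(1 + (\<Sum>\<^sub>\<infinity>(n, j, r)\<in>UNIV - {(0, 0, 0)}. triple_term q n j r))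
           * qpoch_inf_list [q ^ 2, q ^ 3, q ^ 9, q ^ 10] (q ^ 12) = 1"
proof -
  define S where "S = 1 + (\<Sum>\<^sub>\<infinity>(n, j, r)\<in>UNIV - {(0, 0, 0)}. triple_term q n j r)"
  define Q where "Q a b = qpoch_inf (q ^ a) (q ^ b)" for a b
  define Q' where "Q' a b = qpoch_inf (- (q ^ a)) (q ^ b)" for a b
  have mag: "mag (q ^ a) < 1" if "a > 0" for a
    using that q(1) by (rule mag_power_less_1[rotated])
  have nz: "Q a b \<noteq> 0" if "a > 0" "b > 0" for a b
    unfolding Q_def using that by (intro qpoch_inf_nonzero mag)
  have split: "Q a b = Q a (2 * b) * Q (a + b) (2 * b)" if "a > 0" "b > 0" for a b
    using qpoch_inf_even_odd[OF mag mag, of b a] that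
    by (simp add: Q_def power_add mult.commute[of 2] power_mult)
  have minus: "Q a b * Q' a b = Q (2 * a) (2 * b)" if "a > 0" "b > 0" for a b
    using qpoch_inf_mult_minus[OF mag mag, of b a] that
    by (simp add: Q_def Q'_def mult.commute[of 2] power_mult)

  define \<theta> where "\<theta> = infsum (theta_term q) UNIV"
  have 1: "S * Q 3 3 = \<theta>"
  proof (rule LIMSEQ_unique)
    let ?p = "q ^ 3"
    show "(\<lambda>N. (\<Sum>(n, j, r)\<in>truncation N. triple_term q n j r
            * (qpoch ?p ?p N * (1 div qpoch ?p ?p (N - (n + j + r))))) * qpoch ?p ?p (2 * N))
          \<longlonglongrightarrow> S * Q 3 3"
      unfolding S_def Q_def
      by (intro tendsto_mult triple_limit qpoch_double_index_tendsto q mag) auto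
    show "(\<lambda>N. (\<Sum>(n, j, r)\<in>truncation N. triple_term q n j r
            * (qpoch ?p ?p N * (1 div qpoch ?p ?p (N - (n + j + r))))) * qpoch ?p ?p (2 * N))
          \<longlonglongrightarrow> \<theta>"
      using theta_limit[OF q(1) mag[of 3]] unfolding finite_triple_sum[OF q] \<theta>_def
      by (simp add: mult_ac)
  qed
  have 2: "Q 6 6 * (Q' 2 6 * Q' 4 6) = \<theta>"
  proof (rule LIMSEQ_unique)
    let ?p = "q ^ 6"
    show "(\<lambda>N. qpoch ?p ?p N * (qpoch (- (q ^ 2)) ?p N * qpoch (- (q ^ 4)) ?p N))
          \<longlonglongrightarrow> Q 6 6 * (Q' 2 6 * Q' 4 6)"
      unfolding Q_def Q'_def by (intro tendsto_mult qpoch_tendsto_qpoch_inf) (simp_all add: mag)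
    show "(\<lambda>N. qpoch ?p ?p N * (qpoch (- (q ^ 2)) ?p N * qpoch (- (q ^ 4)) ?p N)) \<longlonglongrightarrow> \<theta>"
      using theta_limit[OF q(1) mag[of 6]] unfolding finite_theta_product[OF q, symmetric] \<theta>_def
      by (simp add: mult_ac)
  qed
  \<comment> \<open>\<open>Q a b\<close> and \<open>Q' a b\<close> stand for \<open>(q ^ a; q ^ b)\<close> and \<open>(- (q ^ a); q ^ b)\<close>; \<open>Q 6 6\<close> occurs on both sides and cancels\<close>
  have 3: "Q 3 3 = Q 3 12 * Q 9 12 * Q 6 6"
    using split[of 3 3] split[of 3 6] by simp
  have "S * (Q 3 12 * Q 9 12) * Q 6 6 = Q' 2 6 * Q' 4 6 * Q 6 6"
    using 1 2 by (simp only: 3 mult_ac)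
  then have 4: "S * (Q 3 12 * Q 9 12) = Q' 2 6 * Q' 4 6"
    using nz[of 6 6] by simp
  have "(Q 2 6 * Q' 2 6) * (Q 4 6 * Q' 4 6) = Q 4 12 * Q 8 12"
    using minus[of 2 6] minus[of 4 6] by simp
  moreover have "Q 2 6 = Q 2 12 * Q 8 12" "Q 4 6 = Q 4 12 * Q 10 12"
    using split[of 2 6] split[of 4 6] by simp_all
  ultimately have "(Q' 2 6 * Q' 4 6 * (Q 2 12 * Q 10 12)) * (Q 4 12 * Q 8 12) = 1 * (Q 4 12 * Q 8 12)"
    by (simp only: mult_ac mult_1_left)
  then have "Q' 2 6 * Q' 4 6 * (Q 2 12 * Q 10 12) = 1"
    using nz[of 4 12] nz[of 8 12] by (subst (asm) mult_right_cancel) simp_all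
  then have "S * (Q 2 12 * (Q 3 12 * (Q 9 12 * Q 10 12))) = 1"
    unfolding 4[symmetric] by (simp only: mult_ac)
  then show ?thesis
    by (simp add: S_def Q_def qpoch_inf_list_def)
qed

lemma triple_sum_eq:
  fixes q :: "'a::complete_normed_domain"
  assumes q: "mag q < 1" "q \<noteq> 0"
  shows "(\<lambda>(n, j, r). triple_term q n j r) summable_on (UNIV - {(0, 0, 0)})"
    and "1 + (\<Sum>\<^sub>\<infinity>(n, j, r) \<in> UNIV - {(0, 0, 0)}. triple_term q n j r)
           = 1 div qpoch_inf_list [q ^ 2, q ^ 3, q ^ 9, q ^ 10] (q ^ 12)"
proof -
  have "(\<lambda>x. mag (case x of (n, j, r) \<Rightarrow> triple_term q n j r)) summable_on UNIV - {(0, 0, 0)}"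
    using summable_on_subset_banach[OF triple_term_summable[OF q(1)]] by (simp add: case_prod_unfold)
  then show "(\<lambda>(n, j, r). triple_term q n j r) summable_on (UNIV - {(0, 0, 0)})"
    by (rule mag_summable_imp_summable_on)
  let ?S = "1 + (\<Sum>\<^sub>\<infinity>(n, j, r)\<in>UNIV - {(0, 0, 0)}. triple_term q n j r)"
  let ?Q = "qpoch_inf_list [q ^ 2, q ^ 3, q ^ 9, q ^ 10] (q ^ 12)"
  have "?S * ?Q = 1"
    by (rule triple_sum_times_product[OF q])
  then have "?Q \<noteq> 0"
    by auto
  from nonzero_mult_div_cancel_right[OF this, of ?S] show "?S = 1 div ?Q"
    unfolding \<open>?S * ?Q = 1\<close> ..
qed

section \<open>The analytic identity\<close>

text \<open>
  At \<open>q = 0\<close> powers of \<open>q\<close> cannot be cancelled, but there every term of the sum vanishes.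
\<close>
lemma triple_sum_0:
  "(\<lambda>(n, j, r). triple_term (0::complex) n j r) summable_on (UNIV - {(0, 0, 0)})"
  "1 + (\<Sum>\<^sub>\<infinity>(n, j, r) \<in> UNIV - {(0, 0, 0)}. triple_term (0::complex) n j r)
     = 1 / qpoch_inf_list [0 ^ 2, 0 ^ 3, 0 ^ 9, 0 ^ 10] (0 ^ 12)"
proof -
  have 0: "(case x of (n, j, r) \<Rightarrow> triple_term (0::complex) n j r) = 0" if "x \<in> UNIV - {(0, 0, 0)}" for x
  proof -
    obtain n j r where x: "x = (n, j, r)"
      by (cases x)
    then have "triple_exponent n j r > 0"
      using triple_exponent_ge[of n j r] that by auto
    then show ?thesis
      by (simp add: x triple_term_def)
  qed
  then show "(\<lambda>(n, j, r). triple_term (0::complex) n j r) summable_on (UNIV - {(0, 0, 0)})"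
    by (subst summable_on_cong[of _ _ "\<lambda>_. 0"]) auto
  have "(\<Sum>\<^sub>\<infinity>(n, j, r) \<in> UNIV - {(0, 0, 0)}. triple_term (0::complex) n j r) = 0"
    using 0 by (rule infsum_0)
  then show "1 + (\<Sum>\<^sub>\<infinity>(n, j, r) \<in> UNIV - {(0, 0, 0)}. triple_term (0::complex) n j r)
     = 1 / qpoch_inf_list [0 ^ 2, 0 ^ 3, 0 ^ 9, 0 ^ 10] (0 ^ 12)"
    by (simp add: qpoch_inf_list_def qpoch_inf_def)
qed

lemma mag_complex [simp]: "mag (z :: complex) = norm z"
  by (simp add: mag_def)

text \<open>
  On a closed disc of radius less than 1 the factors differ from 1 by at most a geometric sequence,
  so the polynomial partial products converge uniformly there.
\<close>
lemma qpoch_inf_power_holomorphic: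
  assumes "a > 0" "b > 0"
  shows "(\<lambda>z::complex. qpoch_inf (z ^ a) (z ^ b)) holomorphic_on ball 0 1"
proof (rule holomorphic_uniform_sequence)
  show "(\<lambda>z::complex. qpoch (z ^ a) (z ^ b) n) holomorphic_on ball 0 1" for n
    unfolding qpoch_def by (intro holomorphic_intros)
  fix z :: complex assume z: "z \<in> ball 0 1"
  define d where "d = (1 - norm z) / 2"
  define \<rho> where "\<rho> = norm z + d"
  have d: "d > 0" "\<rho> < 1" "\<rho> \<ge> 0"
    using z by (auto simp: d_def \<rho>_def field_simps)
  have le: "norm w \<le> \<rho>" if "w \<in> cball z d" for w
    using that norm_triangle_ineq[of "w - z" z] by (simp add: \<rho>_def dist_norm norm_minus_commute)
  then have sub: "cball z d \<subseteq> ball 0 1"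
    using d(2) by fastforce
  have "uniform_limit (cball z d) (\<lambda>n w. qpoch (w ^ a) (w ^ b) n) (\<lambda>w. qpoch_inf (w ^ a) (w ^ b)) sequentially"
  proof -
    have "uniformly_convergent_on (cball z d) (\<lambda>n w. qpoch (w ^ a) (w ^ b) n)"
      unfolding qpoch_def
    proof (rule uniformly_convergent_on_prod')
      show "uniformly_convergent_on (cball z d) (\<lambda>N w. \<Sum>i<N. norm (1 - w ^ a * (w ^ b) ^ i - 1))"
      proof (rule Weierstrass_m_test')
        show "norm (norm (1 - w ^ a * (w ^ b) ^ i - 1)) \<le> \<rho> ^ i" if "w \<in> cball z d" for w i
        proof -
          have "norm (1 - w ^ a * (w ^ b) ^ i - 1) = norm w ^ (a + b * i)"
            by (simp add: norm_mult norm_power power_add power_mult)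
          also have "\<dots> \<le> \<rho> ^ (a + b * i)"
            by (intro power_mono le that) auto
          also have "\<dots> \<le> \<rho> ^ i"
            using d \<open>b > 0\<close> by (intro power_decreasing) (auto simp: trans_le_add2)
          finally show ?thesis
            by simp
        qed
        show "summable (\<lambda>i. \<rho> ^ i)"
          using d by (simp add: summable_geometric)
      qed
    qed (auto intro!: continuous_intros)
    then obtain g where g: "uniform_limit (cball z d) (\<lambda>n w. qpoch (w ^ a) (w ^ b) n) g sequentially"
      by (auto simp: uniformly_convergent_on_def)
    have "g w = qpoch_inf (w ^ a) (w ^ b)" if "w \<in> cball z d" for w
    proof (rule LIMSEQ_unique)
      show "(\<lambda>n. qpoch (w ^ a) (w ^ b) n) \<longlonglongrightarrow> g w"
        by (rule tendsto_uniform_limitI[OF g that])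
      have "norm w < 1"
        using that sub by auto
      then show "(\<lambda>n. qpoch (w ^ a) (w ^ b) n) \<longlonglongrightarrow> qpoch_inf (w ^ a) (w ^ b)"
        using assms by (intro qpoch_tendsto_qpoch_inf mag_power_less_1) auto
    qed
    then show ?thesis
      using g by (subst uniform_limit_cong'[where i = g]) auto
  qed
  with d sub show "\<exists>d>0. cball z d \<subseteq> ball 0 1 \<and>
      uniform_limit (cball z d) (\<lambda>n w. qpoch (w ^ a) (w ^ b) n) (\<lambda>w. qpoch_inf (w ^ a) (w ^ b)) sequentially"
    by blast
qed simp

theorem corollary3p5:
  shows "((\<lambda>(n, j, r). triple_term (fps_X :: 'a::field_char_0 fps) n j r)
             summable_on (UNIV - {(0, 0, 0)}) \<and>
          1 + (\<Sum>\<^sub>\<infinity>(n, j, r) \<in> UNIV - {(0, 0, 0)}. triple_term (fps_X :: 'a fps) n j r)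
            = 1 / qpoch_inf_list [fps_X ^ 2, fps_X ^ 3, fps_X ^ 9, fps_X ^ 10] (fps_X ^ 12)) \<and>
         (\<lambda>q :: complex. 1 + (\<Sum>\<^sub>\<infinity>(n, j, r) \<in> UNIV - {(0, 0, 0)}. triple_term q n j r))
             analytic_on ball 0 1 \<and>
         (\<forall>q :: complex. norm q < 1 \<longrightarrow>
           (\<lambda>(n, j, r). triple_term q n j r) summable_on (UNIV - {(0, 0, 0)}) \<and>
           1 + (\<Sum>\<^sub>\<infinity>(n, j, r) \<in> UNIV - {(0, 0, 0)}. triple_term q n j r)
             = 1 / qpoch_inf_list [q ^ 2, q ^ 3, q ^ 9, q ^ 10] (q ^ 12))"
proof (intro conjI)
  have X: "mag (fps_X :: 'a fps) < 1" "(fps_X :: 'a fps) \<noteq> 0"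
    by (simp_all add: mag_def dist_fps_def)
  show "(\<lambda>(n, j, r). triple_term (fps_X :: 'a fps) n j r) summable_on (UNIV - {(0, 0, 0)})"
    and "1 + (\<Sum>\<^sub>\<infinity>(n, j, r) \<in> UNIV - {(0, 0, 0)}. triple_term (fps_X :: 'a fps) n j r)
            = 1 / qpoch_inf_list [fps_X ^ 2, fps_X ^ 3, fps_X ^ 9, fps_X ^ 10] (fps_X ^ 12)"
    by (rule triple_sum_eq[OF X])+
  have sum: "(\<lambda>(n, j, r). triple_term q n j r) summable_on (UNIV - {(0, 0, 0)}) \<and>
           1 + (\<Sum>\<^sub>\<infinity>(n, j, r) \<in> UNIV - {(0, 0, 0)}. triple_term q n j r)
             = 1 / qpoch_inf_list [q ^ 2, q ^ 3, q ^ 9, q ^ 10] (q ^ 12)"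
    if "norm q < 1" for q :: complex
    using triple_sum_0 triple_sum_eq[of q] that by (cases "q = 0") auto
  then show "\<forall>q :: complex. norm q < 1 \<longrightarrow>
           (\<lambda>(n, j, r). triple_term q n j r) summable_on (UNIV - {(0, 0, 0)}) \<and>
           1 + (\<Sum>\<^sub>\<infinity>(n, j, r) \<in> UNIV - {(0, 0, 0)}. triple_term q n j r)
             = 1 / qpoch_inf_list [q ^ 2, q ^ 3, q ^ 9, q ^ 10] (q ^ 12)"
    by blast
  have nz: "qpoch_inf_list [q ^ 2, q ^ 3, q ^ 9, q ^ 10] (q ^ 12) \<noteq> 0" if "norm q < 1" for q :: complex
    using that by (auto simp: qpoch_inf_list_def qpoch_inf_nonzero mag_power_less_1 power_less_one_iff norm_power)
  \<comment> \<open>analyticity of the sum is read off from the product side\<close>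
  have "(\<lambda>q :: complex. 1 / qpoch_inf_list [q ^ 2, q ^ 3, q ^ 9, q ^ 10] (q ^ 12)) holomorphic_on ball 0 1"
  proof (rule holomorphic_on_divide)
    show "(\<lambda>q :: complex. qpoch_inf_list [q ^ 2, q ^ 3, q ^ 9, q ^ 10] (q ^ 12)) holomorphic_on ball 0 1"
      unfolding qpoch_inf_list_def
      by (simp, intro holomorphic_intros qpoch_inf_power_holomorphic) auto
  qed (use nz in auto)
  then have "(\<lambda>q :: complex. 1 + (\<Sum>\<^sub>\<infinity>(n, j, r) \<in> UNIV - {(0, 0, 0)}. triple_term q n j r))
      holomorphic_on ball 0 1"
    by (rule holomorphic_transform) (use sum in auto)
  then show "(\<lambda>q :: complex. 1 + (\<Sum>\<^sub>\<infinity>(n, j, r) \<in> UNIV - {(0, 0, 0)}. triple_term q n j r))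
      analytic_on ball 0 1"
    by (simp add: analytic_on_open)
qed

end
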